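(* Let $a,b,d$ be positive integers and let $\Theta=((12),\ldots,(12),(1)(2))\in S_2^{\,d}\times S_2$ be the isotopism whose first $d$ components are the transposition $(12)$ and whose last component is the identity of $S_2$. Then: (i) if $d=2$, ${}^{(a,b)}\chi_g^{\Theta}(H_2)={}^{(a,b)}\chi_g(K_2^{\ast 2})=2$; (ii) if $d=3$, ${}^{(a,b)}\chi_g^{\Theta}(H_3)={}^{(a,b)}\chi_g(K_4^{\ast 2})=4$; (iii) if $d=4$, $${}^{(a,b)}\chi_{g_X}^{\Theta}(H_4)={}^{(a,b)}\chi_{g_X}(K_{4,4}^{\ast 2})=\begin{cases}2,&\text{if }X=A\text{ and }a\ge 2,\\ \min\{b+2,5\},&\text{if }X=A\text{ and }a=1,\\ \min\{b+1,5\},&\text{if }X=B\text{ and }a=1.\end{cases}$$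
   Context: $H_d=\mathcal{H}_{2,\ldots,2}=K_2\Box\cdots\Box K_2$ ($d$ factors) is the $d$-dimensional hypercube graph, with vertices (cells) $[2]^d$, $[m]=\{1,\ldots,m\}$; two cells are adjacent (collinear) iff they differ in exactly one coordinate. $K_m$ is the complete graph, $K_{4,4}$ the complete bipartite graph. For a graph $G$, $G^{\ast l}$ is the vertex-weighted graph with base graph $G$ in which every vertex has weight $l$. Write $\Theta=(\pi_1,\ldots,\pi_d,\pi)\in S_{n_1}\times\cdots\times S_{n_d}\times S_n$ (here all $n_j=n=2$). The natural extension of $\Theta$ of size $n'\ge n$ is $\Theta'=(\pi_1,\ldots,\pi_d,\pi')$ with $\pi'\in S_{n'}$, $\pi'(s)=\pi(s)$ for $s\le n$ and $\pi'(s)=s$ for $n<s\le n'$. $l_{\sigma,s}$ is the length of the cycle of the permutation $\sigma$ containing $s$. A $k$-tuple of positive integers is in $\mathcal{C}_k$ (lcm-compatible) if the lcm of any $k-1$ of its entries equals the lcm of all entries. A partial colouring $P$ of the cells by $[n']$ is $\Theta'$-compatible if for every non-empty cell $(i_1,\ldots,i_d)$: $(l_{\pi_1,i_1},\ldots,l_{\pi_d,i_d},l_{\pi',P(i_1,\ldots,i_d)})\in\mathcal{C}_{d+1}$, and for every positive integer $m$ the cell $(\pi_1^m(i_1),\ldots,\pi_d^m(i_d))$ is either empty or contains $(\pi')^m(P(i_1,\ldots,i_d))$. $\Theta$-stabilized $(a,b)$-colouring game with $n'$ colours: starting from the empty board, Alice and Bob alternately move; a move of Alice (Bob) consists of $\min\{a,u\}$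 (resp. $\min\{b,u\}$) successive turns, where $u$ is the number of uncoloured cells before the move. In a turn an empty cell $(i_1,\ldots,i_d)$ receives a symbol $s\in[n']$ such that: (Rule 1) adjacent coloured cells have different colours afterwards; (Rule 2) the resulting partial colouring is $\Theta'$-compatible; (Rule 3) for each positive integer $m<\mathrm{lcm}(l_{\pi_1,i_1},\ldots,l_{\pi_d,i_d})$ and each coloured cell $(i_1',\ldots,i_d')$ collinear with $(\pi_1^m(i_1),\ldots,\pi_d^m(i_d))$, $P(i_1',\ldots,i_d')\ne(\pi')^m(s)$. Alice wins if all cells are coloured at the end; otherwise Bob wins. In variant $g_A$ Alice moves first, in variant $g_B$ Bob moves first. ${}^{(a,b)}\chi_{g_X}^{\Theta}(H_d)$ ($X\in\{A,B\}$) is the smallest size $n'\geq n$ of a natural extension of $\Theta$ for which Alice has a winning strategy in variant $g_X$. Modified $(a,b)$-colouring game on a vertex-weighted graph with $k$ colours: Alice and Bob alternate, making $a$, respectively $b$, turns per move (or as many as remain possible, i.e. the total remaining weight, if that is less). Each turn is one of: (1) colour an uncoloured vertex $v$ with one of the $k$ colours different from the colours of its neighbours, and replace its weight $\omega(v)$ by $\omega(v)-1$; (2) for an already coloured vertex $v$ with $\omega(v)>0$, replace $\omega(v)$ by $\omega(v)-1$. Alice wins if every vertex is coloured at the end of the game; otherwise Bob wins. For a vertex-weighted graph $W$, ${}^{(a,b)}\chi_{g_X}(W)$ is the least $k$ such that Alice has a winning strategy in this modified game with $k$ colours when Alice ($X=A$) or Bob ($X=B$) moves first. An unsubscripted $\chi_g$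 means that the assertion holds for each of the two variants $g_A$, $g_B$. *)

theory Defs
  imports
    Graph_Theory.Kuratowski
    "HOL-Combinatorics.Permutations"
    "HOL-Combinatorics.Orbits"
begin

section \<open>Alternating games and winning strategies\<close>

datatype player = Alice | Bob

text \<open>
  Turns are numbered from 0; the player \<open>X\<close> makes the first move, and a move of Alice (Bob)
  consists of \<open>a\<close> (\<open>b\<close>) consecutive turns.  A move is shorter only when no cell (no weight)
  remains, that is, when the game is over, so the owner of every turn that is actually made
  depends only on its number.
\<close>

definition alice_turn :: "player \<Rightarrow> nat \<Rightarrow> nat \<Rightarrow> nat \<Rightarrow> bool" where
  "alice_turn X a b t \<longleftrightarrow>
     (case X of Alice \<Rightarrow> t mod (a + b) < a | Bob \<Rightarrow> b \<le> t mod (a + b))"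

text \<open>
  A strategy of Alice maps the list of all positions so far (from the initial one to the current
  one) to the next position.  The plays consistent with a strategy \<open>\<sigma>\<close>, for the turn relation
  \<open>turn\<close> and the initial position \<open>p0\<close>:
\<close>

inductive consistent_play ::
  "player \<Rightarrow> nat \<Rightarrow> nat \<Rightarrow> ('p \<Rightarrow> 'p \<Rightarrow> bool) \<Rightarrow> 'p \<Rightarrow> ('p list \<Rightarrow> 'p) \<Rightarrow> 'p list \<Rightarrow> bool"
  for X :: player and a b :: nat and turn :: "'p \<Rightarrow> 'p \<Rightarrow> bool" and p0 :: 'p
    and \<sigma> :: "'p list \<Rightarrow> 'p"
where
  start: "consistent_play X a b turn p0 \<sigma> [p0]"
| alice: "\<lbrakk>consistent_play X a b turn p0 \<sigma> h; alice_turn X a b (length h - 1);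
           turn (last h) (\<sigma> h)\<rbrakk>
          \<Longrightarrow> consistent_play X a b turn p0 \<sigma> (h @ [\<sigma> h])"
| bob:   "\<lbrakk>consistent_play X a b turn p0 \<sigma> h; \<not> alice_turn X a b (length h - 1);
           turn (last h) p\<rbrakk>
          \<Longrightarrow> consistent_play X a b turn p0 \<sigma> (h @ [p])"

text \<open>
  A strategy is winning if every consistent play that cannot be continued ends in a position
  satisfying \<open>won\<close>.  A strategy prescribing an illegal turn in a position that is not \<open>won\<close> is
  therefore not winning.  In the games below there are no infinite plays.
\<close>

definition winning_strategy ::
  "player \<Rightarrow> nat \<Rightarrow> nat \<Rightarrow> ('p \<Rightarrow> 'p \<Rightarrow> bool) \<Rightarrow> 'p \<Rightarrow> ('p \<Rightarrow> bool) \<Rightarrow> ('p list \<Rightarrow> 'p) \<Rightarrow> bool"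
where
  "winning_strategy X a b turn p0 won \<sigma> \<longleftrightarrow>
     (\<forall>h. consistent_play X a b turn p0 \<sigma> h
        \<and> (\<nexists>p. consistent_play X a b turn p0 \<sigma> (h @ [p])) \<longrightarrow> won (last h))"

definition alice_wins ::
  "player \<Rightarrow> nat \<Rightarrow> nat \<Rightarrow> ('p \<Rightarrow> 'p \<Rightarrow> bool) \<Rightarrow> 'p \<Rightarrow> ('p \<Rightarrow> bool) \<Rightarrow> bool"
where
  "alice_wins X a b turn p0 won \<longleftrightarrow> (\<exists>\<sigma>. winning_strategy X a b turn p0 won \<sigma>)"


section \<open>The modified colouring game on vertex-weighted graphs\<close>

type_synonym ('v, 'e) vwgraph = "('v, 'e) pre_digraph \<times> ('v \<Rightarrow> nat)"

definition uniform_weight :: "('v, 'e) pre_digraph \<Rightarrow> nat \<Rightarrow> ('v, 'e) vwgraph" where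
  "uniform_weight G l = (G, \<lambda>_. l)"

text \<open>A position consists of a partial colouring and the current weights.\<close>

definition modified_turn ::
  "('v, 'e) pre_digraph \<Rightarrow> nat \<Rightarrow> ('v \<rightharpoonup> nat) \<times> ('v \<Rightarrow> nat) \<Rightarrow> ('v \<rightharpoonup> nat) \<times> ('v \<Rightarrow> nat) \<Rightarrow> bool"
where
  "modified_turn G k = (\<lambda>(P, w) (P', w').
     (\<exists>v \<in> verts G - dom P. \<exists>s \<in> {1..k}.
        (\<forall>u. u \<rightarrow>\<^bsub>G\<^esub> v \<longrightarrow> P u \<noteq> Some s) \<and> P' = P(v \<mapsto> s) \<and> w' = w(v := w v - 1)) \<or>
     (\<exists>v \<in> verts G \<inter> dom P. 0 < w v \<and> P' = P \<and> w' = w(v := w v - 1)))"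

definition modified_game_chi :: "player \<Rightarrow> nat \<Rightarrow> nat \<Rightarrow> ('v, 'e) vwgraph \<Rightarrow> nat" where
  "modified_game_chi X a b W =
     (LEAST k. alice_wins X a b (modified_turn (fst W) k)
                 (Map.empty, snd W) (\<lambda>(P, w). verts (fst W) \<subseteq> dom P))"


section \<open>Hamming graphs and hypercubes\<close>

definition hamming_graph :: "nat list \<Rightarrow> nat list pair_pre_digraph" where
  "hamming_graph ns =
     (let C = {c. length c = length ns \<and> (\<forall>j < length ns. c ! j \<in> {1..ns ! j})}
      in \<lparr>pverts = C,
          parcs = {(c, c') \<in> C \<times> C. \<exists>!j. j < length ns \<and> c ! j \<noteq> c' ! j}\<rparr>)"

definition hypercube :: "nat \<Rightarrow> nat list pair_pre_digraph" where
  "hypercube d = hamming_graph (replicate d 2)"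


section \<open>The colouring game stabilized by an isotopism\<close>

text \<open>
  An isotopism consists of the list of the permutations acting on the coordinates and the
  permutation acting on the symbols.
\<close>

type_synonym isotopism = "(nat \<Rightarrow> nat) list \<times> (nat \<Rightarrow> nat)"

text \<open>
  Here \<open>n\<close> is the degree of the symbol permutation.  As permutations are functions on all natural
  numbers, the extension does not depend on its size \<open>n' \<ge> n\<close>.
\<close>

definition natural_extension :: "nat \<Rightarrow> isotopism \<Rightarrow> isotopism" where
  "natural_extension n \<Theta> = (fst \<Theta>, \<lambda>s. if s \<le> n then snd \<Theta> s else s)"

definition cycle_length :: "(nat \<Rightarrow> nat) \<Rightarrow> nat \<Rightarrow> nat" where
  "cycle_length \<sigma> s = card (orbit \<sigma> s)"

definition cell_cycle_lengths :: "isotopism \<Rightarrow> nat list \<Rightarrow> nat list" where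
  "cell_cycle_lengths \<Theta> c = map2 cycle_length (fst \<Theta>) c"

definition move_cell :: "isotopism \<Rightarrow> nat \<Rightarrow> nat list \<Rightarrow> nat list" where
  "move_cell \<Theta> m c = map2 (\<lambda>\<pi> i. (\<pi> ^^ m) i) (fst \<Theta>) c"

definition lcm_compatible :: "nat list \<Rightarrow> bool" where
  "lcm_compatible ls \<longleftrightarrow> (\<forall>l \<in> set ls. 0 < l) \<and>
     (\<forall>i < length ls. Lcm ((!) ls ` ({..<length ls} - {i})) = Lcm (set ls))"

definition compatible :: "isotopism \<Rightarrow> (nat list \<rightharpoonup> nat) \<Rightarrow> bool" where
  "compatible \<Theta> P \<longleftrightarrow> (\<forall>c s. P c = Some s \<longrightarrow>
     lcm_compatible (cell_cycle_lengths \<Theta> c @ [cycle_length (snd \<Theta>) s]) \<and>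
     (\<forall>m > 0. P (move_cell \<Theta> m c) \<in> {None, Some ((snd \<Theta> ^^ m) s)}))"

text \<open>
  One turn on the board \<open>H\<close> with symbols \<open>{1..n'}\<close>, where \<open>\<Theta>\<close> is the already extended isotopism.
  All three rules are evaluated on the board after the turn.
\<close>

definition stabilized_turn ::
  "isotopism \<Rightarrow> nat list pair_pre_digraph \<Rightarrow> nat \<Rightarrow>
   (nat list \<rightharpoonup> nat) \<Rightarrow> (nat list \<rightharpoonup> nat) \<Rightarrow> bool"
where
  "stabilized_turn \<Theta> H n' P P' \<longleftrightarrow>
     (\<exists>c \<in> pverts H - dom P. \<exists>s \<in> {1..n'}. P' = P(c \<mapsto> s) \<and>
        (\<forall>u \<in> dom P'. \<forall>v \<in> dom P'. (u, v) \<in> parcs H \<longrightarrow> P' u \<noteq> P' v) \<and>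
        compatible \<Theta> P' \<and>
        (\<forall>m. 0 < m \<and> m < Lcm (set (cell_cycle_lengths \<Theta> c)) \<longrightarrow>
           (\<forall>c' \<in> dom P'. (c', move_cell \<Theta> m c) \<in> parcs H \<longrightarrow>
              P' c' \<noteq> Some ((snd \<Theta> ^^ m) s))))"

definition stabilized_game_chi ::
  "player \<Rightarrow> nat \<Rightarrow> nat \<Rightarrow> nat \<Rightarrow> isotopism \<Rightarrow> nat list pair_pre_digraph \<Rightarrow> nat"
where
  "stabilized_game_chi X a b n \<Theta> H =
     (LEAST n'. n \<le> n' \<and>
        alice_wins X a b (stabilized_turn (natural_extension n \<Theta>) H n')
          Map.empty (\<lambda>P. pverts H \<subseteq> dom P))"

end

theory Submission
  imports Defs
begin

text \<open>
  All coordinates are transposed and all symbols are fixed, so the isotopism sends each cell to its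
  antipode and does not touch symbols.  The rules of the stabilized game then say that the two cells
  of an antipodal pair carry the same symbol, and that a symbol is forbidden in a pair as soon as it
  occurs in a pair containing a collinear cell.  Identifying antipodal cells turns the hypercube
  into the folded cube, and a turn of the stabilized game into a turn of the modified game on the
  folded cube with all weights 2: the first cell of a pair to be filled colours the vertex, the
  second one only uses up weight.  This correspondence is a bisimulation
  (\<open>stabilized_win_iff_modified_win\<close>), and bisimilar games have the same winner because winning is
  a matter of positions and not of histories.

  The folded cubes of dimension 2, 3 and 4 are \<open>K\<^bsub>2\<^esub>\<close>, \<open>K\<^bsub>4\<^esub>\<close> and \<open>K\<^bsub>4,4\<^esub>\<close>, and it remains to play
  the modified game there.  On \<open>K\<^bsub>n\<^esub>\<close> with \<open>n\<close> colours no vertex ever runs out of colours, and with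
  fewer colours there is no proper colouring at all.

  On \<open>K\<^bsub>n,n\<^esub>\<close> everything is decided at the beginning.  A colour used on one side is reserved for
  that side, so as soon as both sides contain a coloured vertex, no vertex can be blocked any more.
  Bob can only win by putting all \<open>k\<close> colours on one side before the other side is touched.  That
  needs \<open>k \<le> n\<close>.  The opening turn always colours a vertex, and Alice answers on the other side as
  soon as she has a turn after it; hence Bob succeeds iff he makes at least \<open>k - 1\<close> turns between
  the opening turn and Alice's next turn.  He makes \<open>b - 1\<close> of them if he starts, \<open>b\<close> if Alice
  starts with a single turn, and none if Alice starts with two or more.  Lowering the
  weight of a coloured vertex brings no colour onto the board, so such turns only slow Bob down.
\<close>

section \<open>Positional winning regions\<close>

text \<open>
  A set of positions, indexed by the number of turns made, in which Alice never has to look at the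
  history of the play.  On Alice's turn \<open>won\<close> is an alternative to a successor even if the game
  goes on: a strategy may prescribe an illegal turn in such a position, and the play then ends in
  her favour.
\<close>

definition winning_region ::
  "player \<Rightarrow> nat \<Rightarrow> nat \<Rightarrow> ('p \<Rightarrow> 'p \<Rightarrow> bool) \<Rightarrow> ('p \<Rightarrow> bool) \<Rightarrow> (nat \<Rightarrow> 'p \<Rightarrow> bool) \<Rightarrow> bool"
where
  "winning_region X a b turn won I \<longleftrightarrow> (\<forall>t p. I t p \<longrightarrow>
     (if alice_turn X a b t then won p \<or> (\<exists>p'. turn p p' \<and> I (Suc t) p')
      else ((\<nexists>p'. turn p p') \<longrightarrow> won p) \<and> (\<forall>p'. turn p p' \<longrightarrow> I (Suc t) p')))"

lemma consistent_play_nonempty: "consistent_play X a b turn p0 \<sigma> h \<Longrightarrow> h \<noteq> []"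
  by (induction rule: consistent_play.induct) auto

text \<open>
  Choosing a successor inside the region whenever there is one keeps every consistent play inside.
\<close>

lemma alice_wins_if_winning_region:
  assumes irrefl: "\<And>p. \<not> turn p p"
    and region: "winning_region X a b turn won I" and "I 0 p0"
  shows "alice_wins X a b turn p0 won"
proof -
  \<comment> \<open>Repeating the current position is never a legal turn, so it serves as the prescription where
      the region has no successor; if Alice is to move there, the position is already won.\<close>
  define \<sigma> where "\<sigma> h = (if \<exists>p'. turn (last h) p' \<and> I (length h) p'
      then SOME p'. turn (last h) p' \<and> I (length h) p' else last h)" for h
  have chosen: "turn (last h) (\<sigma> h) \<and> I (length h) (\<sigma> h)"
    if "\<exists>p'. turn (last h) p' \<and> I (length h) p'" for h
    using someI_ex[OF that] that by (simp add: \<sigma>_def)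
  have legal_only_if_chosen: "\<exists>p'. turn (last h) p' \<and> I (length h) p'" if "turn (last h) (\<sigma> h)" for h
    using that irrefl by (auto simp: \<sigma>_def split: if_splits)
  have inv: "I (length h - 1) (last h)" if "consistent_play X a b turn p0 \<sigma> h" for h
    using that
  proof induction
    case start
    then show ?case using \<open>I 0 p0\<close> by simp
  next
    case (alice h)
    then show ?case using chosen legal_only_if_chosen by fastforce
  next
    case (bob h p)
    then have "Suc (length h - 1) = length h"
      using consistent_play_nonempty by fastforce
    then show ?case using bob region unfolding winning_region_def by (metis diff_Suc_1 last_snoc length_append_singleton)
  qed
  have "won (last h)"
    if h: "consistent_play X a b turn p0 \<sigma> h"
      and maximal: "\<nexists>p. consistent_play X a b turn p0 \<sigma> (h @ [p])" for h
  proof -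
    have "Suc (length h - 1) = length h"
      using consistent_play_nonempty[OF h] by (cases h) auto
    moreover have "\<not> turn (last h) (\<sigma> h)" if "alice_turn X a b (length h - 1)"
      using maximal alice[OF h that] by blast
    moreover have "\<not> turn (last h) p" if "\<not> alice_turn X a b (length h - 1)" for p
      using maximal bob[OF h that] by blast
    ultimately show ?thesis
      using inv[OF h] region chosen[of h] unfolding winning_region_def by (metis (full_types))
  qed
  then show ?thesis
    unfolding alice_wins_def winning_strategy_def by blast
qed

text \<open>
  The positions reached by the plays consistent with a winning strategy form a winning region.
  Together with the preceding lemma this makes winning independent of the history.
\<close>

lemma winning_region_if_alice_wins:
  assumes "alice_wins X a b turn p0 won"
  shows "\<exists>I. winning_region X a b turn won I \<and> I 0 p0"
proof -
  obtain \<sigma> where \<sigma>: "winning_strategy X a b turn p0 won \<sigma>"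
    using assms unfolding alice_wins_def by blast
  define I where "I t p \<longleftrightarrow>
    (\<exists>h. consistent_play X a b turn p0 \<sigma> h \<and> length h = Suc t \<and> last h = p)" for t p
  have "if alice_turn X a b t then won p \<or> (\<exists>p'. turn p p' \<and> I (Suc t) p')
      else ((\<nexists>p'. turn p p') \<longrightarrow> won p) \<and> (\<forall>p'. turn p p' \<longrightarrow> I (Suc t) p')" if region: "I t p" for t p
  proof -
    obtain h where h: "consistent_play X a b turn p0 \<sigma> h" "length h = Suc t" "last h = p"
      using region unfolding I_def by blast
    have last: "won p" if "\<nexists>p'. consistent_play X a b turn p0 \<sigma> (h @ [p'])"
      using \<sigma> h that unfolding winning_strategy_def by blast
    have ext: "turn p p' \<and> (alice_turn X a b t \<longrightarrow> p' = \<sigma> h)"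
      if "consistent_play X a b turn p0 \<sigma> (h @ [p'])" for p'
      using that
    proof cases
      case start
      then show ?thesis using h by simp
    next
      case (alice h')
      then show ?thesis using h by simp
    next
      case (bob h' p'')
      then show ?thesis using h by simp
    qed
    show ?thesis
    proof (cases "alice_turn X a b t")
      case True
      show ?thesis
      proof (cases "turn p (\<sigma> h)")
        case legal: True
        then have "consistent_play X a b turn p0 \<sigma> (h @ [\<sigma> h])"
          using consistent_play.alice[OF h(1)] True h by simp
        then have "I (Suc t) (\<sigma> h)"
          using h(2) unfolding I_def by (intro exI[of _ "h @ [\<sigma> h]"]) simp
        then show ?thesis using legal True by auto
      next
        case False
        then have "won p" using last ext True by blast
        then show ?thesis using True by simp
      qed
    next
      case False
      then have "consistent_play X a b turn p0 \<sigma> (h @ [p'])" if "turn p p'" for p'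
        using consistent_play.bob[OF h(1)] h that by simp
      then have "I (Suc t) p'" if "turn p p'" for p'
        using h(2) that unfolding I_def by (intro exI[of _ "h @ [p']"]) simp
      then show ?thesis using False last ext by auto
    qed
  qed
  moreover have "I 0 p0"
    unfolding I_def by (intro exI[of _ "[p0]"]) (simp add: consistent_play.start)
  ultimately show ?thesis unfolding winning_region_def by blast
qed

text \<open>
  If Bob can maintain an invariant that excludes \<open>won\<close>, a position in both the invariant and a
  winning region of Alice always has a successor of the same kind, which is impossible because
  \<open>size\<close> decreases.  Bob's move is only required where some turn exists: in a winning region of
  Alice, Bob is never stuck in a position that is not won.
\<close>

lemma not_alice_wins_if_bob_invariant:
  fixes size :: "'p \<Rightarrow> nat"
  assumes "J 0 p0" and "\<And>t p. J t p \<Longrightarrow> \<not> won p"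
    and "\<And>t p p'. J t p \<Longrightarrow> alice_turn X a b t \<Longrightarrow> turn p p' \<Longrightarrow> J (Suc t) p'"
    and "\<And>t p p'. J t p \<Longrightarrow> \<not> alice_turn X a b t \<Longrightarrow> turn p p' \<Longrightarrow> \<exists>q. turn p q \<and> J (Suc t) q"
    and decreasing: "\<And>p p'. turn p p' \<Longrightarrow> size p' < size p"
  shows "\<not> alice_wins X a b turn p0 won"
proof
  assume "alice_wins X a b turn p0 won"
  then obtain I where I: "winning_region X a b turn won I" "I 0 p0"
    using winning_region_if_alice_wins by metis
  have False if "I t p" "J t p" for t p
    using that
  proof (induction "size p" arbitrary: t p rule: less_induct)
    case less
    then have "\<not> won p" using assms(2) by blast
    then have "\<exists>p'. turn p p' \<and> I (Suc t) p' \<and> J (Suc t) p'"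
      using less.prems I(1) assms(3,4) unfolding winning_region_def by (metis (full_types))
    then show False using less.hyps decreasing by blast
  qed
  then show False using I(2) assms(1) by blast
qed

text \<open>
  The winning region is transported along the simulation.  The two winning conditions are compared
  in terminal positions only: in the application below, the modified game can be won long before
  the corresponding board of the stabilized game is full.
\<close>

lemma alice_wins_if_simulation:
  assumes irrefl: "\<And>q. \<not> turn' q q" and "R p0 q0"
    and persistent: "\<And>p p'. won p \<Longrightarrow> turn p p' \<Longrightarrow> won p'"
    and won: "\<And>p q. R p q \<Longrightarrow> \<nexists>p'. turn p p' \<Longrightarrow> \<nexists>q'. turn' q q' \<Longrightarrow> won p \<Longrightarrow> won' q"
    and simulates: "\<And>p q p'. R p q \<Longrightarrow> turn p p' \<Longrightarrow> \<exists>q'. turn' q q' \<and> R p' q'"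
    and simulated: "\<And>p q q'. R p q \<Longrightarrow> turn' q q' \<Longrightarrow> \<exists>p'. turn p p' \<and> R p' q'"
    and "alice_wins X a b turn p0 won"
  shows "alice_wins X a b turn' q0 won'"
proof -
  obtain I where I: "winning_region X a b turn won I" "I 0 p0"
    using winning_region_if_alice_wins[OF assms(7)] by blast
  \<comment> \<open>In a position that is already won the region may offer no successor, but every continuation
      stays won.\<close>
  define I' where "I' t q \<longleftrightarrow> (\<exists>p. R p q \<and> (I t p \<or> won p))" for t q
  have "if alice_turn X a b t then won' q \<or> (\<exists>q'. turn' q q' \<and> I' (Suc t) q')
      else ((\<nexists>q'. turn' q q') \<longrightarrow> won' q) \<and> (\<forall>q'. turn' q q' \<longrightarrow> I' (Suc t) q')" if q: "I' t q" for t q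
  proof -
    obtain p where p: "R p q" "I t p \<or> won p" using q unfolding I'_def by blast
    have region: "if alice_turn X a b t then won p \<or> (\<exists>p'. turn p p' \<and> I (Suc t) p')
      else ((\<nexists>p'. turn p p') \<longrightarrow> won p) \<and> (\<forall>p'. turn p p' \<longrightarrow> I (Suc t) p')" if "I t p"
      using I(1) that unfolding winning_region_def by blast
    have stuck: "won' q" if "\<nexists>q'. turn' q q'"
    proof -
      have "\<nexists>p'. turn p p'" using simulates[OF p(1)] that by blast
      moreover from this have "won p" using p(2) region by (cases "alice_turn X a b t") auto
      ultimately show ?thesis using won[OF p(1)] that by blast
    qed
    show ?thesis
    proof (cases "alice_turn X a b t")
      case True
      have "\<exists>q'. turn' q q' \<and> I' (Suc t) q'" if "\<exists>q'. turn' q q'"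
      proof (cases "won p")
        case True
        then show ?thesis
          using that simulated[OF p(1)] persistent unfolding I'_def by blast
      next
        case False
        then obtain p' where "turn p p'" "I (Suc t) p'"
          using p(2) region \<open>alice_turn X a b t\<close> by auto
        then show ?thesis using simulates[OF p(1)] unfolding I'_def by blast
      qed
      then show ?thesis using True stuck by auto
    next
      case False
      have "I' (Suc t) q'" if step: "turn' q q'" for q'
      proof -
        obtain p' where p': "turn p p'" "R p' q'" using simulated[OF p(1) step] by blast
        then have "I (Suc t) p' \<or> won p'"
          using p(2) region False persistent by auto
        then show ?thesis using p'(2) unfolding I'_def by blast
      qed
      then show ?thesis using False stuck by auto
    qed
  qed
  then have "winning_region X a b turn' won' I'"
    unfolding winning_region_def by blast
  moreover have "I' 0 q0" using \<open>R p0 q0\<close> I(2) unfolding I'_def by blast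
  ultimately show ?thesis
    using alice_wins_if_winning_region[where turn = turn', OF irrefl] by blast
qed

lemma alice_wins_iff_bisimulation:
  assumes "\<And>p. \<not> turn p p" and "\<And>q. \<not> turn' q q" and "R p0 q0"
    and "\<And>p p'. won p \<Longrightarrow> turn p p' \<Longrightarrow> won p'" and "\<And>q q'. won' q \<Longrightarrow> turn' q q' \<Longrightarrow> won' q'"
    and won: "\<And>p q. R p q \<Longrightarrow> \<nexists>p'. turn p p' \<Longrightarrow> \<nexists>q'. turn' q q' \<Longrightarrow> won p \<longleftrightarrow> won' q"
    and simulates: "\<And>p q p'. R p q \<Longrightarrow> turn p p' \<Longrightarrow> \<exists>q'. turn' q q' \<and> R p' q'"
    and simulated: "\<And>p q q'. R p q \<Longrightarrow> turn' q q' \<Longrightarrow> \<exists>p'. turn p p' \<and> R p' q'"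
  shows "alice_wins X a b turn p0 won \<longleftrightarrow> alice_wins X a b turn' q0 won'"
proof
  assume win: "alice_wins X a b turn p0 won"
  show "alice_wins X a b turn' q0 won'"
    by (rule alice_wins_if_simulation[where R = R and turn = turn and won = won and ?p0.0 = p0])
      (fact assms win | rule iffD1[OF won], assumption+)+
next
  assume win: "alice_wins X a b turn' q0 won'"
  show "alice_wins X a b turn p0 won"
    by (rule alice_wins_if_simulation[where R = "\<lambda>q p. R p q" and turn = turn' and won = won'
          and ?p0.0 = q0])
      (fact assms win | rule iffD2[OF won], assumption+)+
qed

section \<open>The modified game on a finite graph\<close>

lemma modified_turn_iff:
  "modified_turn G k (P, w) q \<longleftrightarrow>
     (\<exists>v \<in> verts G - dom P. \<exists>s \<in> {1..k}.
        (\<forall>u. u \<rightarrow>\<^bsub>G\<^esub> v \<longrightarrow> P u \<noteq> Some s) \<and> q = (P(v \<mapsto> s), w(v := w v - 1))) \<or>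
     (\<exists>v \<in> verts G \<inter> dom P. 0 < w v \<and> q = (P, w(v := w v - 1)))"
  unfolding modified_turn_def by (cases q) simp

lemma modified_turn_cases:
  assumes "modified_turn G k (P, w) q"
  obtains (colour) v s where "v \<in> verts G" "P v = None" "s \<in> {1..k}"
      "\<And>u. u \<rightarrow>\<^bsub>G\<^esub> v \<Longrightarrow> P u \<noteq> Some s" "q = (P(v \<mapsto> s), w(v := w v - 1))"
    | (discard) v where "v \<in> verts G" "v \<in> dom P" "0 < w v" "q = (P, w(v := w v - 1))"
  using assms unfolding modified_turn_iff by blast

lemma modified_turn_colour:
  assumes "v \<in> verts G" "P v = None" "s \<in> {1..k}" "\<And>u. u \<rightarrow>\<^bsub>G\<^esub> v \<Longrightarrow> P u \<noteq> Some s"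
  shows "modified_turn G k (P, w) (P(v \<mapsto> s), w(v := w v - 1))"
  unfolding modified_turn_iff using assms by blast

text \<open>
  Every turn lowers this number, but not always by one: colouring a vertex lowers both summands
  unless its weight is 0.
\<close>

definition turn_measure :: "('v, 'e) pre_digraph \<Rightarrow> ('v \<rightharpoonup> nat) \<times> ('v \<Rightarrow> nat) \<Rightarrow> nat" where
  "turn_measure G = (\<lambda>(P, w). card (verts G - dom P) + sum w (verts G))"

abbreviation modified_win ::
  "player \<Rightarrow> nat \<Rightarrow> nat \<Rightarrow> ('v, 'e) pre_digraph \<Rightarrow> nat \<Rightarrow> ('v \<Rightarrow> nat) \<Rightarrow> bool"
where
  "modified_win X a b G k w \<equiv>
     alice_wins X a b (modified_turn G k) (Map.empty, w) (\<lambda>(P, w). verts G \<subseteq> dom P)"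

definition proper_partial ::
  "('v, 'e) pre_digraph \<Rightarrow> nat \<Rightarrow> ('v \<rightharpoonup> nat) \<Rightarrow> bool"
where
  "proper_partial G k P \<longleftrightarrow> dom P \<subseteq> verts G \<and> ran P \<subseteq> {1..k} \<and>
     (\<forall>u v. u \<rightarrow>\<^bsub>G\<^esub> v \<longrightarrow> u \<in> dom P \<longrightarrow> P u \<noteq> P v)"

lemma proper_partial_empty [simp]: "proper_partial G k Map.empty"
  by (simp add: proper_partial_def)

lemma exists_unused_colour:
  assumes "finite S" "card S < k"
  obtains s where "s \<in> {1..k}" "s \<notin> S"
proof -
  have "\<not> {1..k} \<subseteq> S"
    using card_mono[OF assms(1), of "{1..k}"] assms(2) by auto
  then show ?thesis using that by blast
qed

lemma ran_map_upd_None: "P v = None \<Longrightarrow> ran (P(v \<mapsto> s)) = insert s (ran P)"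
  by (rule ran_map_upd)

context graph
begin

lemma turn_measure_decreases:
  assumes "modified_turn G k p p'"
  shows "turn_measure G p' < turn_measure G p"
proof -
  have "turn_measure G p' < turn_measure G (P, w)"
    if "modified_turn G k (P, w) p'" for P w
    using that
  proof (cases rule: modified_turn_cases)
    case (colour v s)
    have "card (verts G - dom (P(v \<mapsto> s))) < card (verts G - dom P)"
      using colour by (intro psubset_card_mono) auto
    moreover have "sum (w(v := w v - 1)) (verts G) \<le> sum w (verts G)"
      by (intro sum_mono) simp
    ultimately show ?thesis using colour by (simp add: turn_measure_def)
  next
    case (discard v)
    have "sum (w(v := w v - 1)) (verts G) < sum w (verts G)"
      by (rule sum_strict_mono_ex1) (use discard in auto)
    then show ?thesis using discard by (simp add: turn_measure_def)
  qed
  then show ?thesis using assms by (cases p) simp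
qed

lemma modified_turn_irrefl: "\<not> modified_turn G k p p"
  using turn_measure_decreases by blast

lemma dominates_sym: "u \<rightarrow>\<^bsub>G\<^esub> v \<Longrightarrow> v \<rightarrow>\<^bsub>G\<^esub> u"
  by (rule arcs_ends_symmetric[OF sym_arcs])

lemma proper_partial_colour:
  assumes "proper_partial G k P" "v \<in> verts G" "P v = None" "s \<in> {1..k}"
    "\<And>u. u \<rightarrow>\<^bsub>G\<^esub> v \<Longrightarrow> P u \<noteq> Some s"
  shows "proper_partial G k (P(v \<mapsto> s))"
proof -
  have "(P(v \<mapsto> s)) x \<noteq> (P(v \<mapsto> s)) y" if "x \<rightarrow>\<^bsub>G\<^esub> y" "x \<in> dom (P(v \<mapsto> s))" for x y
  proof -
    have "x \<noteq> y" using that(1) adj_not_same by auto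
    moreover have "P y \<noteq> Some s" if "x = v"
      using assms(5)[OF dominates_sym[OF \<open>x \<rightarrow>\<^bsub>G\<^esub> y\<close>[unfolded that]]] .
    moreover have "P x \<noteq> Some s" if "y = v"
      using assms(5)[OF \<open>x \<rightarrow>\<^bsub>G\<^esub> y\<close>[unfolded that]] .
    moreover have "P x \<noteq> P y" if "x \<noteq> v"
      using assms(1) \<open>x \<rightarrow>\<^bsub>G\<^esub> y\<close> \<open>x \<in> dom (P(v \<mapsto> s))\<close> that unfolding proper_partial_def by simp
    ultimately show ?thesis by (metis fun_upd_apply)
  qed
  then show ?thesis
    using assms unfolding proper_partial_def by (auto simp: ran_map_upd_None)
qed

lemma proper_partial_turn:
  assumes "proper_partial G k P" "modified_turn G k (P, w) (P', w')"
  shows "proper_partial G k P'"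
  using assms(2)
proof (cases rule: modified_turn_cases)
  case (colour v s)
  then show ?thesis using proper_partial_colour[OF assms(1)] by simp
next
  case (discard v)
  then show ?thesis using assms(1) by simp
qed

lemma dom_turn_mono: "modified_turn G k (P, w) (P', w') \<Longrightarrow> dom P \<subseteq> dom P'"
  by (erule modified_turn_cases) auto

lemma dom_turn_nonempty: "modified_turn G k (P, w) (P', w') \<Longrightarrow> dom P' \<noteq> {}"
  by (erule modified_turn_cases) (auto simp del: dom_eq_empty_conv)

text \<open>
  Both players only ever extend proper partial colourings.  Without a proper colouring by \<open>k\<close>
  colours, being proper is therefore an invariant that serves Bob.
\<close>

lemma proper_colouring_if_modified_win:
  assumes "modified_win X a b G k w"
  shows "\<exists>f. f ` verts G \<subseteq> {1..k} \<and> (\<forall>u v. u \<rightarrow>\<^bsub>G\<^esub> v \<longrightarrow> f u \<noteq> f v)"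
proof (rule ccontr)
  assume no_colouring: "\<not> ?thesis"
  have not_won: "\<not> verts G \<subseteq> dom P" if P: "proper_partial G k P" for P
  proof
    assume "verts G \<subseteq> dom P"
    then have some: "P v = Some (the (P v))" if "v \<in> verts G" for v using that by auto
    have "(\<lambda>v. the (P v)) ` verts G \<subseteq> {1..k}"
    proof
      fix s assume "s \<in> (\<lambda>v. the (P v)) ` verts G"
      then obtain v where "P v = Some s" using some by auto
      then show "s \<in> {1..k}" using P unfolding proper_partial_def by (auto intro: ranI)
    qed
    moreover have "the (P u) \<noteq> the (P v)" if "u \<rightarrow>\<^bsub>G\<^esub> v" for u v
    proof -
      have "P u \<noteq> P v"
        using P that some[OF adj_in_verts(1)[OF that]] unfolding proper_partial_def by blast
      then show ?thesis using some adj_in_verts[OF that] by metis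
    qed
    ultimately have "(\<lambda>v. the (P v)) ` verts G \<subseteq> {1..k} \<and>
        (\<forall>u v. u \<rightarrow>\<^bsub>G\<^esub> v \<longrightarrow> the (P u) \<noteq> the (P v))" by simp
    then show False using no_colouring by (rule notE[rotated, OF exI])
  qed
  have "\<not> modified_win X a b G k w"
  proof (rule not_alice_wins_if_bob_invariant
      [where J = "\<lambda>t (P, w). proper_partial G k P" and size = "turn_measure G"])
    show "\<not> (\<lambda>(P, w). verts G \<subseteq> dom P) p"
      if "(\<lambda>(P, w). proper_partial G k P) p" for p :: "('a \<rightharpoonup> nat) \<times> ('a \<Rightarrow> nat)"
      using that not_won by (cases p) simp
    have "(\<lambda>(P, w). proper_partial G k P) p'"
      if "(\<lambda>(P, w). proper_partial G k P) p" "modified_turn G k p p'" for p p'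
      using that proper_partial_turn by (cases p; cases p') simp
    then show "(\<lambda>(P, w). proper_partial G k P) p'"
      and "\<exists>q. modified_turn G k p q \<and> (\<lambda>(P, w). proper_partial G k P) q"
      if "(\<lambda>(P, w). proper_partial G k P) p" "modified_turn G k p p'" for p p'
      using that by blast+
  qed (simp_all add: turn_measure_decreases)
  then show False using assms by blast
qed

text \<open>
  The greedy bound: some colour is free at every vertex in every position, so a play cannot end
  before everything is coloured.
\<close>

lemma modified_win_if_degree_less:
  assumes "\<And>v. v \<in> verts G \<Longrightarrow> card {u. u \<rightarrow>\<^bsub>G\<^esub> v} < k"
  shows "modified_win X a b G k w"
proof -
  have turn: "\<exists>q. modified_turn G k (P, w) q" if uncoloured: "\<not> verts G \<subseteq> dom P" for P w
  proof -
    obtain v where v: "v \<in> verts G" "P v = None" using uncoloured by blast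
    let ?S = "(\<lambda>u. the (P u)) ` {u. u \<rightarrow>\<^bsub>G\<^esub> v}"
    have "finite {u. u \<rightarrow>\<^bsub>G\<^esub> v}"
      using adj_in_verts(1) by (intro finite_subset[OF _ finite_verts]) blast
    then have "finite ?S" "card ?S < k"
      using card_image_le[of "{u. u \<rightarrow>\<^bsub>G\<^esub> v}" "\<lambda>u. the (P u)"] assms[OF v(1)] by auto
    then obtain s where s: "s \<in> {1..k}" "s \<notin> ?S" by (rule exists_unused_colour)
    then have "P u \<noteq> Some s" if "u \<rightarrow>\<^bsub>G\<^esub> v" for u using that by force
    then show ?thesis using modified_turn_colour[of v G P s k] v s(1) by blast
  qed
  have "winning_region X a b (modified_turn G k) (\<lambda>(P, w). verts G \<subseteq> dom P) (\<lambda>_ _. True)"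
    unfolding winning_region_def
  proof (intro allI impI)
    fix t :: nat and p :: "('a \<rightharpoonup> nat) \<times> ('a \<Rightarrow> nat)"
    show "if alice_turn X a b t then (\<lambda>(P, w). verts G \<subseteq> dom P) p \<or> (\<exists>p'. modified_turn G k p p' \<and> True)
      else ((\<nexists>p'. modified_turn G k p p') \<longrightarrow> (\<lambda>(P, w). verts G \<subseteq> dom P) p) \<and>
        (\<forall>p'. modified_turn G k p p' \<longrightarrow> True)"
      using turn[of "fst p" "snd p"] by (cases p) auto
  qed
  then show ?thesis
    using alice_wins_if_winning_region[where turn = "modified_turn G k", OF modified_turn_irrefl] by blast
qed

end

section \<open>Complete graphs\<close>

lemma modified_win_complete_iff:
  fixes G :: "('v, 'e) pre_digraph"
  assumes "K\<^bsub>n\<^esub> G"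
  shows "modified_win X a b G k w \<longleftrightarrow> n \<le> k"
proof -
  interpret graph G using assms unfolding complete_digraph_def by blast
  have adj: "u \<rightarrow>\<^bsub>G\<^esub> v \<longleftrightarrow> u \<in> verts G \<and> v \<in> verts G \<and> u \<noteq> v" and n: "card (verts G) = n" for u v
    using assms unfolding complete_digraph_def by auto
  show ?thesis
  proof
    assume "modified_win X a b G k w"
    then obtain f where f: "f ` verts G \<subseteq> {1..k}" "\<And>u v. u \<rightarrow>\<^bsub>G\<^esub> v \<Longrightarrow> f u \<noteq> f v"
      using proper_colouring_if_modified_win by blast
    then have "inj_on f (verts G)" unfolding inj_on_def adj by blast
    then show "n \<le> k" using card_inj_on_le[of f "verts G" "{1..k}"] f(1) n by simp
  next
    assume "n \<le> k"
    have "card {u. u \<rightarrow>\<^bsub>G\<^esub> v} < k" if v: "v \<in> verts G" for v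
    proof -
      have "{u. u \<rightarrow>\<^bsub>G\<^esub> v} = verts G - {v}" using v by (auto simp: adj)
      moreover have "card (verts G - {v}) < card (verts G)" using v by (intro card_Diff1_less) auto
      ultimately show ?thesis using n \<open>n \<le> k\<close> by simp
    qed
    then show "modified_win X a b G k w" by (rule modified_win_if_degree_less)
  qed
qed

section \<open>Complete bipartite graphs\<close>

locale bipartite_game = graph G for G :: "('v, 'e) pre_digraph" +
  fixes U V :: "'v set" and n :: nat
  assumes sides: "verts G = U \<union> V" "U \<inter> V = {}"
    and sizes: "card U = n" "card V = n" "0 < n"
    and adj: "arcs_ends G = U \<times> V \<union> V \<times> U"
begin

text \<open>
  This is why Alice only has to worry about the beginning of the game: a colour that occurs on one
  side can never occur on the other one, hence it stays available for its own side forever.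
\<close>

lemma free_turn_if_both_sides_touched:
  assumes P: "proper_partial G k P" and "dom P \<inter> U \<noteq> {}" "dom P \<inter> V \<noteq> {}"
    and "\<not> verts G \<subseteq> dom P"
  shows "\<exists>q. modified_turn G k (P, w) q"
proof -
  obtain v where v: "v \<in> verts G" "P v = None" using assms(4) by blast
  obtain u where u: "u \<in> dom P" "\<forall>x. x \<rightarrow>\<^bsub>G\<^esub> v \<longrightarrow> u \<rightarrow>\<^bsub>G\<^esub> x"
    using assms(2,3) v(1) sides adj by (cases "v \<in> U") auto
  obtain s where s: "P u = Some s" using u(1) by blast
  have "P x \<noteq> Some s" if "x \<rightarrow>\<^bsub>G\<^esub> v" for x
    using P u that s unfolding proper_partial_def by metis
  moreover have "s \<in> {1..k}" using P s unfolding proper_partial_def by (metis ranI subsetD)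
  ultimately show ?thesis using modified_turn_colour[of v G P s k] v by blast
qed

lemma colour_with_unused:
  assumes "proper_partial G k P" "card (ran P) < k" "v \<in> verts G" "P v = None"
  shows "\<exists>s. modified_turn G k (P, w) (P(v \<mapsto> s), w(v := w v - 1)) \<and>
    proper_partial G k (P(v \<mapsto> s)) \<and> card (ran (P(v \<mapsto> s))) = Suc (card (ran P))"
proof -
  have fin: "finite (ran P)" using assms(1) unfolding proper_partial_def by (metis finite_atLeastAtMost finite_subset)
  then obtain s where s: "s \<in> {1..k}" "s \<notin> ran P" using assms(2) by (rule exists_unused_colour)
  then have "P u \<noteq> Some s" for u by (metis ranI)
  then show ?thesis
    using assms s fin proper_partial_colour[of k P v s] modified_turn_colour[of v G P s k]
    by (intro exI[of _ s]) (simp add: ran_map_upd_None)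
qed

lemma card_ran_turn:
  assumes "proper_partial G k P" "modified_turn G k (P, w) (P', w')"
  shows "card (ran P) \<le> card (ran P')" "card (ran P') \<le> Suc (card (ran P))"
proof -
  have fin: "finite (ran P)" using assms(1) unfolding proper_partial_def by (metis finite_atLeastAtMost finite_subset)
  show "card (ran P) \<le> card (ran P')" "card (ran P') \<le> Suc (card (ran P))"
    using assms(2) by (cases rule: modified_turn_cases; simp add: ran_map_upd_None fin card_insert_if)+
qed

text \<open>
  As long as only one side is touched, at most one new colour appears per turn.  Before turn \<open>T\<close>
  fewer than \<open>k\<close> colours are in use whatever the players do, so in turn \<open>T\<close> at the latest Alice can
  put an unused colour on the other side, after which both sides are safe.
\<close>

lemma modified_win_if_alice_turn:
  assumes T: "alice_turn X a b T" "0 < T" "T < k"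
  shows "modified_win X a b G k w"
proof -
  \<comment> \<open>Since \<open>T < k\<close>, the bound in \<open>one\<close> leaves an unused colour up to turn \<open>T\<close>.  The board is not
      empty after the opening turn, so in turn \<open>T\<close> a single further vertex makes \<open>both\<close> true.\<close>
  define both where "both P \<longleftrightarrow> dom P \<inter> U \<noteq> {} \<and> dom P \<inter> V \<noteq> {}" for P :: "'v \<rightharpoonup> nat"
  define one where "one t P \<longleftrightarrow> t \<le> T \<and> card (ran P) \<le> t \<and> (0 < t \<longrightarrow> dom P \<noteq> {}) \<and> \<not> both P"
    for t and P :: "'v \<rightharpoonup> nat"
  define I where "I t = (\<lambda>(P, w :: 'v \<Rightarrow> nat). proper_partial G k P \<and> (both P \<or> one t P))" for t
  have turn: "\<exists>q. modified_turn G k (P, w) q" if I: "I t (P, w)" "\<not> verts G \<subseteq> dom P" for t P w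
  proof (cases "both P")
    case True
    then show ?thesis using free_turn_if_both_sides_touched I unfolding I_def both_def by simp
  next
    case False
    then have "card (ran P) < k" using I(1) T(3) unfolding I_def one_def by simp
    moreover obtain v where "v \<in> verts G" "P v = None" using I(2) by blast
    ultimately show ?thesis using colour_with_unused[of k P v] I(1) unfolding I_def by blast
  qed
  have stays: "I (Suc t) q"
    if "I t (P, w)" "modified_turn G k (P, w) q" and not_last: "both P \<or> t \<noteq> T" for t P w q
  proof -
    obtain P' w' where q: "q = (P', w')" by (cases q)
    have P: "proper_partial G k P" using that(1) unfolding I_def by simp
    have P': "proper_partial G k P'" "dom P \<subseteq> dom P'" "dom P' \<noteq> {}"
      using proper_partial_turn[OF P] dom_turn_mono dom_turn_nonempty that(2) q by blast+
    show ?thesis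
    proof (cases "both P'")
      case True
      then show ?thesis using P' by (simp add: q I_def)
    next
      case False
      then have "\<not> both P" using P'(2) unfolding both_def by blast
      then have "one t P" "t < T" using that(1) not_last unfolding I_def one_def by auto
      then have "one (Suc t) P'"
        using card_ran_turn(2)[OF P that(2)[unfolded q]] P' False unfolding one_def by simp
      then show ?thesis using P' by (simp add: q I_def)
    qed
  qed
  have last: "\<exists>q. modified_turn G k (P, w) q \<and> I (Suc T) q" if I: "I T (P, w)" "\<not> both P" for P w
  proof -
    have P: "proper_partial G k P" "card (ran P) < k" "dom P \<noteq> {}"
      using I T unfolding I_def one_def by auto
    moreover have "dom P \<subseteq> U \<union> V" using P sides unfolding proper_partial_def by simp
    moreover obtain u v where "u \<in> U" "v \<in> V" using sizes by fastforce
    ultimately obtain x where x: "x \<in> verts G" "P x = None" "insert x (dom P) \<inter> U \<noteq> {}" "insert x (dom P) \<inter> V \<noteq> {}"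
      using I(2) sides unfolding both_def by blast
    then show ?thesis
      using colour_with_unused[OF P(1,2) x(1,2)] by (fastforce simp: I_def both_def)
  qed
  have "winning_region X a b (modified_turn G k) (\<lambda>(P, w). verts G \<subseteq> dom P) I"
    unfolding winning_region_def
  proof (intro allI impI)
    fix t p assume I: "I t p"
    obtain P w where p: "p = (P, w)" by (cases p)
    consider "both P \<or> t \<noteq> T" | "\<not> both P" "t = T" by blast
    then show "if alice_turn X a b t then (\<lambda>(P, w). verts G \<subseteq> dom P) p \<or> (\<exists>p'. modified_turn G k p p' \<and> I (Suc t) p')
      else ((\<nexists>p'. modified_turn G k p p') \<longrightarrow> (\<lambda>(P, w). verts G \<subseteq> dom P) p) \<and> (\<forall>p'. modified_turn G k p p' \<longrightarrow> I (Suc t) p')"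
    proof cases
      case 1
      then have "\<forall>q. modified_turn G k p q \<longrightarrow> I (Suc t) q" using stays I p by blast
      moreover have "verts G \<subseteq> dom P \<or> (\<exists>q. modified_turn G k p q)" using turn I p by blast
      ultimately show ?thesis unfolding p prod.case by (simp only: split: if_split) blast
    next
      case 2
      then show ?thesis using last[of P w] T(1) I p by auto
    qed
  qed
  moreover have "I 0 (Map.empty, w)" by (simp add: I_def one_def both_def)
  ultimately show ?thesis
    using alice_wins_if_winning_region[where turn = "modified_turn G k", OF modified_turn_irrefl] by blast
qed

text \<open>
  The first turn has to colour a vertex, whoever makes it.  If all of the next \<open>k - 1\<close> turns belong
  to Bob, he uses them to put the other \<open>k - 1\<close> colours on the same side, which blocks the other
  side for good.
\<close>

lemma not_modified_win_if_bob_turns: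
  assumes bob: "\<And>t. 0 < t \<Longrightarrow> t < k \<Longrightarrow> \<not> alice_turn X a b t" and "k \<le> n"
  shows "\<not> modified_win X a b G k w"
proof -
  \<comment> \<open>From turn \<open>k\<close> on, the invariant says that all \<open>k\<close> colours occur on side \<open>A\<close> and that the other
      side is empty; before that, the bound on the coloured vertices leaves Bob a vertex of \<open>A\<close>.\<close>
  define one where "one A t P \<longleftrightarrow> dom P \<subseteq> A \<and> min t k \<le> card (ran P) \<and> (t < k \<longrightarrow> card (dom P) \<le> t)"
    for A t and P :: "'v \<rightharpoonup> nat"
  define J where "J t = (\<lambda>(P, w :: 'v \<Rightarrow> nat). proper_partial G k P \<and> (one U t P \<or> one V t P))" for t
  have not_won: "\<not> verts G \<subseteq> dom P" if "J t (P, w)" for t P w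
  proof -
    have "dom P \<subseteq> U \<or> dom P \<subseteq> V" using that unfolding J_def one_def by auto
    moreover have "U \<noteq> {}" "V \<noteq> {}" using sizes by auto
    ultimately show ?thesis using sides by blast
  qed
  have lost_stays: "J (Suc t) (P', w')"
    if J: "J t (P, w)" and turn: "modified_turn G k (P, w) (P', w')" and "k \<le> t" for t P w P' w'
  proof -
    have P: "proper_partial G k P" using J unfolding J_def by simp
    obtain A B where AB: "A = U \<and> B = V \<or> A = V \<and> B = U" "one A t P" using J unfolding J_def by auto
    have "ran P = {1..k}"
      using P AB(2) \<open>k \<le> t\<close> unfolding proper_partial_def one_def by (intro card_seteq) auto
    have "dom P' \<subseteq> A"
      using turn
    proof (cases rule: modified_turn_cases)
      case (colour v s)
      have "v \<notin> B"
      proof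
        assume "v \<in> B"
        obtain u where u: "P u = Some s"
          using colour(3) \<open>ran P = {1..k}\<close> unfolding ran_def by blast
        then have "u \<in> A" using AB(2) unfolding one_def by blast
        then show False using u AB(1) adj \<open>v \<in> B\<close> colour(4) by auto
      qed
      then show ?thesis using colour AB sides unfolding one_def by auto
    next
      case (discard v)
      then show ?thesis using AB(2) unfolding one_def by simp
    qed
    then have "one A (Suc t) P'"
      using AB(2) \<open>k \<le> t\<close> card_ran_turn(1)[OF P turn] unfolding one_def by simp
    then show ?thesis using AB(1) proper_partial_turn[OF P turn] unfolding J_def by auto
  qed
  have first: "J (Suc 0) (P', w')"
    if J: "J 0 (P, w)" and turn: "modified_turn G k (P, w) (P', w')" and "0 < k" for P w P' w'
  proof -
    have P: "proper_partial G k P" using J unfolding J_def by simp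
    have "P = Map.empty"
    proof -
      have "card (dom P) = 0" using J \<open>0 < k\<close> unfolding J_def one_def by auto
      moreover have "finite (dom P)" using P finite_verts unfolding proper_partial_def by (metis finite_subset)
      ultimately show ?thesis by simp
    qed
    with turn obtain v s where "v \<in> verts G" "P' = [v \<mapsto> s]" by (auto elim!: modified_turn_cases)
    then have "one U 1 P' \<or> one V 1 P'" using sides unfolding one_def by auto
    then show ?thesis using proper_partial_turn[OF P turn] unfolding J_def by simp
  qed
  have bob_move: "\<exists>q. modified_turn G k (P, w) q \<and> J (Suc t) q"
    if J: "J t (P, w)" and "t < k" for t P w
  proof -
    have P: "proper_partial G k P" using J unfolding J_def by simp
    obtain A where A: "A = U \<or> A = V" "one A t P" using J unfolding J_def by auto
    have "finite (dom P)" using P finite_verts unfolding proper_partial_def by (metis finite_subset)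
    have "card (ran P) \<le> card (dom P)"
    proof -
      have "ran P = (\<lambda>v. the (P v)) ` dom P" unfolding ran_def by force
      then show ?thesis using card_image_le[OF \<open>finite (dom P)\<close>] by metis
    qed
    then have few: "card (ran P) < k" "card (dom P) < card A"
      using A \<open>t < k\<close> \<open>k \<le> n\<close> sizes unfolding one_def by auto
    then have "\<not> A \<subseteq> dom P" using card_mono[OF \<open>finite (dom P)\<close>] by (meson leD)
    then obtain v where v: "v \<in> A" "P v = None" by blast
    then have "v \<in> verts G" using A sides by blast
    obtain s where s: "modified_turn G k (P, w) (P(v \<mapsto> s), w(v := w v - 1))"
      "proper_partial G k (P(v \<mapsto> s))" "card (ran (P(v \<mapsto> s))) = Suc (card (ran P))"
      using colour_with_unused[OF P few(1) \<open>v \<in> verts G\<close> v(2)] by blast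
    have "one A (Suc t) (P(v \<mapsto> s))"
      using A(2) v \<open>t < k\<close> s(3) \<open>finite (dom P)\<close> unfolding one_def by (auto simp: card_insert_if)
    then show ?thesis using s A(1) unfolding J_def by blast
  qed
  show ?thesis
  proof (rule not_alice_wins_if_bob_invariant[where J = J and size = "turn_measure G"])
    show "J 0 (Map.empty, w)" by (simp add: J_def one_def)
    show "\<not> (\<lambda>(P, w). verts G \<subseteq> dom P) p" if "J t p" for t p using not_won that by auto
    show "turn_measure G p' < turn_measure G p" if "modified_turn G k p p'" for p p'
      using turn_measure_decreases that .
    show "J (Suc t) p'" if "J t p" "alice_turn X a b t" "modified_turn G k p p'" for t p p'
    proof -
      have "k \<le> t \<or> t = 0 \<and> 0 < k" using bob that(2) by fastforce
      then show ?thesis using lost_stays first that(1,3) by (metis surj_pair)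
    qed
    show "\<exists>q. modified_turn G k p q \<and> J (Suc t) q" if "J t p" "\<not> alice_turn X a b t" "modified_turn G k p p'" for t p p'
      using lost_stays bob_move that by (metis not_le surj_pair)
  qed
qed

end

text \<open>
  The least number of colours with which Alice wins on \<open>K\<^bsub>n,n\<^esub>\<close>, for positive
  \<open>n\<close>, \<open>a\<close> and \<open>b\<close>.
\<close>

definition bipartite_bound :: "player \<Rightarrow> nat \<Rightarrow> nat \<Rightarrow> nat \<Rightarrow> nat" where
  "bipartite_bound X a b n = (if X = Bob then min (b + 1) (n + 1)
     else if a = 1 then min (b + 2) (n + 1) else 2)"

text \<open>
  The first turn after the opening turn that belongs to Alice has number \<open>b\<close> if Bob starts,
  \<open>b + 1\<close> if Alice starts with a single turn, and 1 if she has at least two turns.  This number is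
  compared with \<open>k\<close>; with more than \<open>n\<close> colours the greedy bound applies.
\<close>

lemma modified_win_bipartite_iff:
  fixes G :: "('v, 'e) pre_digraph"
  assumes "K\<^bsub>n,n\<^esub> G" "0 < n" "0 < a" "0 < b"
  shows "modified_win X a b G k w \<longleftrightarrow> bipartite_bound X a b n \<le> k"
proof -
  obtain U V where "graph G" "verts G = U \<union> V" "U \<inter> V = {}" "card U = n" "card V = n"
    "arcs_ends G = U \<times> V \<union> V \<times> U"
    using assms(1) unfolding complete_bipartite_digraph_def by blast
  then interpret bipartite_game G U V n
    using \<open>0 < n\<close> by (simp add: bipartite_game_def bipartite_game_axioms_def)
  have two_colours: "2 \<le> k" if win: "modified_win X a b G k w"
  proof -
    obtain f where f: "f ` verts G \<subseteq> {1..k}" "\<And>u v. u \<rightarrow>\<^bsub>G\<^esub> v \<Longrightarrow> f u \<noteq> f v"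
      using proper_colouring_if_modified_win[OF win] by blast
    obtain u v where "u \<in> U" "v \<in> V" using sizes by fastforce
    then have "f u \<noteq> f v" "f u \<in> {1..k}" "f v \<in> {1..k}" using f sides adj by auto
    then show ?thesis by auto
  qed
  have many_colours: "modified_win X a b G k w" if "n < k"
  proof (rule modified_win_if_degree_less)
    fix v assume "v \<in> verts G"
    then have "{u. u \<rightarrow>\<^bsub>G\<^esub> v} = U \<or> {u. u \<rightarrow>\<^bsub>G\<^esub> v} = V" using sides adj by auto
    then show "card {u. u \<rightarrow>\<^bsub>G\<^esub> v} < k" using sizes that by auto
  qed
  consider "X = Bob" | "X = Alice" "a = 1" | "X = Alice" "2 \<le> a"
    using \<open>0 < a\<close> by (cases X) force+
  then show ?thesis
  proof cases
    case 1
    have "alice_turn X a b b" using 1 \<open>0 < a\<close> by (simp add: alice_turn_def)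
    moreover have "\<not> alice_turn X a b t" if "t < b" for t using 1 that by (simp add: alice_turn_def)
    ultimately show ?thesis
      using modified_win_if_alice_turn[of X a b b k] not_modified_win_if_bob_turns[of k X a b]
        many_colours \<open>0 < b\<close> 1 unfolding bipartite_bound_def
      by (cases "b < k"; cases "n < k") (simp_all add: Suc_le_eq not_less min_le_iff_disj)
  next
    case 2
    have "alice_turn X a b (b + 1)" using 2 by (simp add: alice_turn_def)
    moreover have "\<not> alice_turn X a b t" if "0 < t" "t < b + 1" for t using 2 that by (simp add: alice_turn_def)
    ultimately show ?thesis
      using modified_win_if_alice_turn[of X a b "b + 1" k] not_modified_win_if_bob_turns[of k X a b]
        many_colours 2 unfolding bipartite_bound_def
      by (cases "b + 1 < k"; cases "n < k") (simp_all add: Suc_le_eq not_less min_le_iff_disj)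
  next
    case 3
    have "alice_turn X a b 1" using 3 by (simp add: alice_turn_def)
    then show ?thesis
      using modified_win_if_alice_turn[of X a b 1 k] two_colours 3 by (auto simp: bipartite_bound_def)
  qed
qed

section \<open>Antipodal cells of the hypercube\<close>

abbreviation (input) flip :: "nat \<Rightarrow> nat" where
  "flip \<equiv> Transposition.transpose 1 2"

definition antipode :: "nat list \<Rightarrow> nat list" where
  "antipode c = map flip c"

definition cells :: "nat \<Rightarrow> nat list set" where
  "cells d = {c. length c = d \<and> set c \<subseteq> {1, 2}}"

definition hamming_distance :: "nat list \<Rightarrow> nat list \<Rightarrow> nat" where
  "hamming_distance u v = length (filter (\<lambda>(x, y). x \<noteq> y) (zip u v))"

lemma pverts_hypercube: "pverts (hypercube d) = cells d"
  unfolding hypercube_def hamming_graph_def Let_def cells_def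
  by (auto simp: subset_iff in_set_conv_nth)

lemma parcs_hypercube:
  "(u, v) \<in> parcs (hypercube d) \<longleftrightarrow> u \<in> cells d \<and> v \<in> cells d \<and> hamming_distance u v = 1"
proof -
  have "(\<exists>!j. j < d \<and> u ! j \<noteq> v ! j) \<longleftrightarrow> hamming_distance u v = 1" if "length u = d" "length v = d"
  proof -
    have "{j. j < d \<and> u ! j \<noteq> v ! j} = {j. j < length (zip u v) \<and> (case zip u v ! j of (x, y) \<Rightarrow> x \<noteq> y)}"
      using that by auto
    then have "hamming_distance u v = card {j. j < d \<and> u ! j \<noteq> v ! j}"
      unfolding hamming_distance_def length_filter_conv_card by simp
    then show ?thesis by (auto simp: card_1_singleton_iff Ex1_def set_eq_iff)
  qed
  moreover have "(u, v) \<in> parcs (hypercube d) \<longleftrightarrow>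
      u \<in> cells d \<and> v \<in> cells d \<and> (\<exists>!j. j < d \<and> u ! j \<noteq> v ! j)"
    unfolding pverts_hypercube[symmetric] by (auto simp: hypercube_def hamming_graph_def Let_def)
  ultimately show ?thesis unfolding cells_def by auto
qed

lemma finite_cells: "finite (cells d)"
  unfolding cells_def using finite_lists_length_eq[of "{1, 2 :: nat}" d] by (simp add: conj_commute)

lemma antipode_antipode [simp]: "antipode (antipode c) = c"
  by (simp add: antipode_def comp_def)

lemma antipode_in_cells_iff [simp]: "antipode c \<in> cells d \<longleftrightarrow> c \<in> cells d"
proof -
  have "antipode c \<in> cells d" if "c \<in> cells d" for c
    using that by (auto simp: antipode_def cells_def transpose_def)
  from this[of c] this[of "antipode c"] show ?thesis by auto
qed

lemma hamming_distance_eq_0_iff: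
  "length u = length v \<Longrightarrow> hamming_distance u v = 0 \<longleftrightarrow> u = v"
  by (induction rule: list_induct2) (auto simp: hamming_distance_def)

lemma hamming_distance_commute: "hamming_distance u v = hamming_distance v u"
proof (induction u v rule: list_induct2')
qed (auto simp: hamming_distance_def)

text \<open>
  Two cells differ in a coordinate iff the first one agrees there with the antipode of the second
  one, since each coordinate takes two values only.
\<close>

lemma hamming_distance_antipode:
  assumes "length u = length v" "set u \<subseteq> {1, 2}" "set v \<subseteq> {1, 2}"
  shows "hamming_distance u (antipode v) + hamming_distance u v = length u"
  using assms by (induction u v rule: list_induct2) (auto simp: hamming_distance_def antipode_def)

lemma antipode_neq: "c \<in> cells d \<Longrightarrow> 0 < d \<Longrightarrow> antipode c \<noteq> c"
  by (cases c) (auto simp: antipode_def cells_def)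

section \<open>Turns of the stabilized game\<close>

definition swap_isotopism :: "nat \<Rightarrow> isotopism" where
  "swap_isotopism d = (replicate d flip, id)"

lemma natural_extension_swap_isotopism:
  "natural_extension n (swap_isotopism d) = swap_isotopism d"
  by (auto simp: natural_extension_def swap_isotopism_def)

lemma map2_replicate: "length c = d \<Longrightarrow> map2 f (replicate d x) c = map (f x) c"
  by (simp add: zip_replicate1)

lemma move_cell_swap_isotopism:
  assumes "length c = d"
  shows "move_cell (swap_isotopism d) m c = (if even m then c else antipode c)"
proof -
  have "flip ^^ m = (if even m then id else flip)"
    by (induction m) (auto simp: fun_eq_iff)
  then show ?thesis
    using assms by (simp add: move_cell_def swap_isotopism_def map2_replicate antipode_def)
qed

lemma cycle_length_flip: "i \<in> {1, 2} \<Longrightarrow> cycle_length flip i = 2"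
proof -
  assume i: "i \<in> {1, 2}"
  have "orbit flip i \<subseteq> {1, 2}"
  proof
    fix y assume "y \<in> orbit flip i"
    then show "y \<in> {1, 2}" using i by induction auto
  qed
  moreover have "flip i \<in> orbit flip i" "flip (flip i) \<in> orbit flip i"
    by (rule orbit.intros, rule orbit.intros(2), rule orbit.base)
  ultimately have "orbit flip i = {1, 2}" using i by auto
  then show ?thesis by (simp add: cycle_length_def)
qed

lemma cell_cycle_lengths_swap_isotopism:
  assumes "c \<in> cells d"
  shows "cell_cycle_lengths (swap_isotopism d) c = replicate d 2"
proof -
  have "map (cycle_length flip) c = replicate (length c) 2"
    using assms cycle_length_flip by (intro map_replicate_const[THEN trans[rotated]] map_cong) (auto simp: cells_def)
  then show ?thesis
    using assms by (simp add: cell_cycle_lengths_def swap_isotopism_def map2_replicate cells_def)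
qed

text \<open>
  The entries are \<open>d \<ge> 2\<close> copies of 2 and a single 1, so the entry 2 survives the removal
  of any entry.
\<close>

lemma lcm_compatible_swap_isotopism:
  assumes "c \<in> cells d" "2 \<le> d"
  shows "lcm_compatible (cell_cycle_lengths (swap_isotopism d) c @ [cycle_length (snd (swap_isotopism d)) s])"
proof -
  have "orbit id s = {s}" by (auto simp: orbit_altdef)
  then have one: "cycle_length (snd (swap_isotopism d)) s = 1"
    by (simp add: cycle_length_def swap_isotopism_def)
  define ls where "ls = replicate d (2::nat) @ [1]"
  have lcm: "Lcm S = 2" if "2 \<in> S" "S \<subseteq> {1, 2}" for S :: "nat set"
  proof (rule dvd_antisym)
    show "Lcm S dvd 2" using that by (intro Lcm_least) auto
    show "2 dvd Lcm S" using that by (intro dvd_Lcm)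
  qed
  have nth: "ls ! j = (if j < d then 2 else 1)" if "j < length ls" for j
    using that by (auto simp: ls_def nth_append)
  have "Lcm ((!) ls ` ({..<length ls} - {i})) = Lcm (set ls)" for i
  proof -
    \<comment> \<open>The index \<open>j\<close> of an entry 2 that is not removed.\<close>
    obtain j where "j < 2" "j \<noteq> i" by (cases "i = 0") (auto intro: that[of 0] that[of 1])
    then have "2 \<in> (!) ls ` ({..<length ls} - {i})"
      using \<open>2 \<le> d\<close> nth[of j] by (intro rev_image_eqI[of j]) (auto simp: ls_def)
    moreover have "(!) ls ` ({..<length ls} - {i}) \<subseteq> {1, 2}" using nth by auto
    ultimately have "Lcm ((!) ls ` ({..<length ls} - {i})) = 2" by (rule lcm)
    moreover have "Lcm (set ls) = 2" using \<open>2 \<le> d\<close> by (intro lcm) (auto simp: ls_def)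
    ultimately show ?thesis by simp
  qed
  moreover have "\<forall>l \<in> set ls. 0 < l" by (auto simp: ls_def)
  ultimately have "lcm_compatible ls" unfolding lcm_compatible_def by blast
  then show ?thesis
    unfolding cell_cycle_lengths_swap_isotopism[OF assms(1)] one ls_def .
qed

lemma compatible_swap_isotopism_iff:
  assumes "dom P \<subseteq> cells d" "2 \<le> d"
  shows "compatible (swap_isotopism d) P \<longleftrightarrow> (\<forall>c s. P c = Some s \<longrightarrow> P (antipode c) \<in> {None, Some s})"
proof -
  have id: "snd (swap_isotopism d) ^^ m = id" for m
    by (induction m) (auto simp: swap_isotopism_def)
  have "(lcm_compatible (cell_cycle_lengths (swap_isotopism d) c @ [cycle_length (snd (swap_isotopism d)) s]) \<and>
      (\<forall>m > 0. P (move_cell (swap_isotopism d) m c) \<in> {None, Some ((snd (swap_isotopism d) ^^ m) s)}))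
    \<longleftrightarrow> P (antipode c) \<in> {None, Some s}" if "P c = Some s" for c s
  proof -
    have c: "c \<in> cells d" using that assms(1) by blast
    then have "P (move_cell (swap_isotopism d) m c) = (if even m then Some s else P (antipode c))" for m
      using that by (simp add: move_cell_swap_isotopism cells_def)
    then have "(\<forall>m > 0. P (move_cell (swap_isotopism d) m c) \<in> {None, Some ((snd (swap_isotopism d) ^^ m) s)})
      \<longleftrightarrow> P (antipode c) \<in> {None, Some s}"
      by (auto simp: id intro: exI[of _ 1] dest: spec[of _ 1])
    then show ?thesis using lcm_compatible_swap_isotopism[OF c assms(2)] by blast
  qed
  then show ?thesis unfolding compatible_def by blast
qed

definition collinear_up_to_antipode :: "nat \<Rightarrow> nat list \<Rightarrow> nat list \<Rightarrow> bool" where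
  "collinear_up_to_antipode d u v \<longleftrightarrow> u \<in> cells d \<and> v \<in> cells d \<and>
     (hamming_distance u v = 1 \<or> hamming_distance u (antipode v) = 1)"

text \<open>
  Rule 1 forbids the symbols of the cells collinear with \<open>c\<close>, Rule 3 (with \<open>m = 1\<close>) those of the
  cells collinear with the antipode of \<open>c\<close>, and Rule 2 ties the symbol to that of the antipode.
  Conversely, a board meeting the three hypotheses on \<open>P\<close> satisfies the rules elsewhere.
\<close>

lemma stabilized_turn_swap_isotopism_iff:
  assumes "2 \<le> d" and P: "dom P \<subseteq> cells d"
    "\<And>c s. P c = Some s \<Longrightarrow> P (antipode c) \<in> {None, Some s}"
    "\<And>u v. u \<in> dom P \<Longrightarrow> collinear_up_to_antipode d u v \<Longrightarrow> P u \<noteq> P v"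
  shows "stabilized_turn (swap_isotopism d) (hypercube d) k P P' \<longleftrightarrow>
    (\<exists>c s. c \<in> cells d \<and> P c = None \<and> s \<in> {1..k} \<and> P' = P(c \<mapsto> s) \<and> P (antipode c) \<in> {None, Some s} \<and>
       (\<forall>u. collinear_up_to_antipode d u c \<longrightarrow> P u \<noteq> Some s))"
    (is "?L \<longleftrightarrow> ?R")
proof -
  have turn: "(\<forall>u \<in> dom P'. \<forall>v \<in> dom P'. (u, v) \<in> parcs (hypercube d) \<longrightarrow> P' u \<noteq> P' v) \<and>
      compatible (swap_isotopism d) P' \<and>
      (\<forall>m. 0 < m \<and> m < Lcm (set (cell_cycle_lengths (swap_isotopism d) c)) \<longrightarrow>
         (\<forall>c' \<in> dom P'. (c', move_cell (swap_isotopism d) m c) \<in> parcs (hypercube d) \<longrightarrow>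
            P' c' \<noteq> Some ((snd (swap_isotopism d) ^^ m) s))) \<longleftrightarrow>
      P (antipode c) \<in> {None, Some s} \<and>
       (\<forall>u. collinear_up_to_antipode d u c \<longrightarrow> P u \<noteq> Some s)"
    (is "?rule1 P' \<and> ?rule2 P' \<and> ?rule3 P' c s \<longleftrightarrow> ?R1 c s \<and> ?R2 c s")
    if c: "c \<in> cells d" "P c = None" and P': "P' = P(c \<mapsto> s)" for c s P'
  proof -
    have ac: "antipode c \<noteq> c" "antipode c \<in> cells d"
      using antipode_neq c(1) assms(1) by auto
    have len: "length c = d" using c(1) by (simp add: cells_def)
    have self: "hamming_distance c c = 0" "hamming_distance c (antipode c) = d"
      using hamming_distance_antipode[of c c] hamming_distance_eq_0_iff[of c c] c(1) by (auto simp: cells_def)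
    have dom: "dom P' \<subseteq> cells d" using P(1) c P' by auto
    have rule2: "?rule2 P' \<longleftrightarrow> ?R1 c s"
    proof -
      have "P' (antipode x) \<in> {None, Some t}" if "P' x = Some t" "?R1 c s" for x t
      proof (cases "x = c")
        case True
        then show ?thesis using that P' ac(1) by auto
      next
        case False
        then have x: "P x = Some t" using that P' by simp
        show ?thesis
        proof (cases "antipode x = c")
          case True
          then have "antipode c = x" by auto
          then show ?thesis using True x that(2) P' by auto
        next
          case False
          then show ?thesis using P(2)[OF x] P' by simp
        qed
      qed
      moreover have "?R1 c s" if "\<forall>x t. P' x = Some t \<longrightarrow> P' (antipode x) \<in> {None, Some t}"
        using that[rule_format, of c s] P' ac(1) by simp
      ultimately show ?thesis using compatible_swap_isotopism_iff[OF dom assms(1)] by metis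
    qed
    have rule3: "?rule3 P' c s \<longleftrightarrow> (\<forall>u \<in> cells d. hamming_distance u (antipode c) = 1 \<longrightarrow> P u \<noteq> Some s)"
    proof -
      have "Lcm (set (cell_cycle_lengths (swap_isotopism d) c)) = 2"
        using assms(1) by (simp add: cell_cycle_lengths_swap_isotopism[OF c(1)])
      then have "0 < m \<and> m < Lcm (set (cell_cycle_lengths (swap_isotopism d) c)) \<longleftrightarrow> m = 1" for m
        by auto
      moreover have "move_cell (swap_isotopism d) 1 c = antipode c"
        "(snd (swap_isotopism d) ^^ 1) s = s"
        by (simp_all add: move_cell_swap_isotopism[OF len]) (simp add: swap_isotopism_def)
      ultimately have "?rule3 P' c s \<longleftrightarrow>
          (\<forall>u \<in> dom P'. (u, antipode c) \<in> parcs (hypercube d) \<longrightarrow> P' u \<noteq> Some s)" by simp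
      also have "\<dots> \<longleftrightarrow> (\<forall>u \<in> cells d. hamming_distance u (antipode c) = 1 \<longrightarrow> P' u \<noteq> Some s)"
        using dom ac(2) unfolding parcs_hypercube by blast
      moreover have "P' u \<noteq> Some s \<longleftrightarrow> P u \<noteq> Some s" if "hamming_distance u (antipode c) = 1" for u
        using that self assms(1) P' by auto
      ultimately show ?thesis by simp
    qed
    have rule1: "?rule1 P' \<longleftrightarrow> (\<forall>u \<in> cells d. hamming_distance u c = 1 \<longrightarrow> P u \<noteq> Some s)" (is "_ \<longleftrightarrow> ?R")
    proof
      assume r: "?rule1 P'"
      show ?R
      proof (intro ballI impI notI)
        fix u assume u: "u \<in> cells d" "hamming_distance u c = 1" "P u = Some s"
        then have "u \<noteq> c" using self by auto
        then have "P' u = Some s" "P' c = Some s" using u P' by auto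
        moreover have "(u, c) \<in> parcs (hypercube d)" using u c by (simp add: parcs_hypercube)
        ultimately show False using r by (metis domI)
      qed
    next
      assume r: ?R
      show "?rule1 P'"
      proof (intro ballI impI)
        fix u v assume uv: "u \<in> dom P'" "v \<in> dom P'" "(u, v) \<in> parcs (hypercube d)"
        then have cells: "u \<in> cells d" "v \<in> cells d" "hamming_distance u v = 1" by (auto simp: parcs_hypercube)
        consider "u = c" "v \<noteq> c" | "u \<noteq> c" "v = c" | "u \<noteq> c" "v \<noteq> c"
          using cells(3) self(1) by (cases "u = c"; cases "v = c") auto
        then show "P' u \<noteq> P' v"
        proof cases
          case 1
          then show ?thesis using r cells P' hamming_distance_commute[of u v] by auto
        next
          case 2
          then show ?thesis using r cells P' by auto
        next
          case 3
          then have "u \<in> dom P" "P' u = P u" "P' v = P v" using uv P' by auto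
          moreover have "collinear_up_to_antipode d u v"
            using cells by (simp add: collinear_up_to_antipode_def)
          ultimately show ?thesis using P(3) by metis
        qed
      qed
    qed
    show ?thesis unfolding rule1 rule2 rule3 collinear_up_to_antipode_def using c by blast
  qed
  show "?L \<longleftrightarrow> ?R"
  proof
    assume "stabilized_turn (swap_isotopism d) (hypercube d) k P P'"
    then obtain c where c: "c \<in> cells d - dom P"
      and "\<exists>s \<in> {1..k}. P' = P(c \<mapsto> s) \<and> ?rule1 P' \<and> ?rule2 P' \<and> ?rule3 P' c s"
      unfolding stabilized_turn_def pverts_hypercube by (rule bexE)
    then obtain s where s: "s \<in> {1..k}" "P' = P(c \<mapsto> s)"
      and rules: "?rule1 P' \<and> ?rule2 P' \<and> ?rule3 P' c s"
      by (elim bexE conjE) (intro that conjI)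
    have "c \<in> cells d" "P c = None" using c by auto
    then have "?R1 c s \<and> ?R2 c s" by (rule iffD1[OF turn[OF _ _ s(2)] rules])
    then show ?R using \<open>c \<in> cells d\<close> \<open>P c = None\<close> s by blast
  next
    assume ?R
    then obtain c s where "c \<in> cells d" "P c = None" "s \<in> {1..k}" "P' = P(c \<mapsto> s)" "?R1 c s \<and> ?R2 c s"
      by blast
    moreover from this have "?rule1 P' \<and> ?rule2 P' \<and> ?rule3 P' c s" using turn by blast
    moreover have "c \<in> pverts (hypercube d) - dom P"
      using calculation(1,2) by (auto simp: pverts_hypercube)
    ultimately show "stabilized_turn (swap_isotopism d) (hypercube d) k P P'"
      unfolding stabilized_turn_def by (intro bexI[of _ c] bexI[of _ s] conjI) blast+
  qed
qed

section \<open>The folded cube\<close>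

definition representative :: "nat list \<Rightarrow> nat list" where
  "representative c = (if hd c = 1 then c else antipode c)"

definition folded_cube :: "nat \<Rightarrow> nat list pair_pre_digraph" where
  "folded_cube d = \<lparr>pverts = {c \<in> cells d. hd c = 1},
     parcs = {(u, v). u \<in> cells d \<and> hd u = 1 \<and> v \<in> cells d \<and> hd v = 1 \<and> collinear_up_to_antipode d u v}\<rparr>"

lemma pverts_folded_cube: "v \<in> pverts (folded_cube d) \<longleftrightarrow> v \<in> cells d \<and> hd v = 1"
  by (simp add: folded_cube_def)

lemma hamming_distance_antipodes: "hamming_distance (antipode u) (antipode v) = hamming_distance u v"
proof (induction u v rule: list_induct2')
qed (auto simp: hamming_distance_def antipode_def inj_eq[OF inj_transpose])

lemma collinear_up_to_antipode_antipode [simp]: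
  "collinear_up_to_antipode d (antipode u) v \<longleftrightarrow> collinear_up_to_antipode d u v"
  "collinear_up_to_antipode d u (antipode v) \<longleftrightarrow> collinear_up_to_antipode d u v"
  using hamming_distance_antipodes[of u v] hamming_distance_antipodes[of u "antipode v"]
  by (auto simp: collinear_up_to_antipode_def)

lemma collinear_up_to_antipode_sym:
  "collinear_up_to_antipode d u v \<Longrightarrow> collinear_up_to_antipode d v u"
  using hamming_distance_antipodes[of u "antipode v"] hamming_distance_commute[of u v]
    hamming_distance_commute[of "antipode u" v]
  by (auto simp: collinear_up_to_antipode_def)

lemma parcs_folded_cube:
  "(u, v) \<in> parcs (folded_cube d) \<longleftrightarrow>
     u \<in> pverts (folded_cube d) \<and> v \<in> pverts (folded_cube d) \<and> collinear_up_to_antipode d u v"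
  by (auto simp: folded_cube_def)

lemma representative_collinear [simp]:
  "collinear_up_to_antipode d (representative u) v \<longleftrightarrow> collinear_up_to_antipode d u v"
  "collinear_up_to_antipode d u (representative v) \<longleftrightarrow> collinear_up_to_antipode d u v"
  by (simp_all add: representative_def)

lemma hd_antipode:
  assumes "c \<in> cells d" "0 < d"
  shows "hd (antipode c) = 1 \<longleftrightarrow> hd c \<noteq> 1"
  using assms by (cases c) (auto simp: antipode_def cells_def)

lemma representative_in_folded_cube:
  assumes "c \<in> cells d" "0 < d"
  shows "representative c \<in> pverts (folded_cube d)"
  using assms hd_antipode[OF assms] by (auto simp: representative_def pverts_folded_cube)

lemma representative_antipode:
  assumes "c \<in> cells d" "0 < d"
  shows "representative (antipode c) = representative c"
  using hd_antipode[OF assms] by (auto simp: representative_def)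

lemma representative_eq_iff:
  assumes "c \<in> cells d" "0 < d" "v \<in> pverts (folded_cube d)"
  shows "representative c = v \<longleftrightarrow> c = v \<or> c = antipode v"
  using assms hd_antipode[of c d] hd_antipode[of v d]
  by (auto simp: representative_def pverts_folded_cube)

text \<open>
  The board \<open>P\<close> corresponds to the position obtained by folding each antipodal pair to a vertex: the
  vertex has the colour that occurs in the pair, and its weight counts the empty cells of the pair.
  Properness of the folded colouring contains all that the three rules say about \<open>P\<close>.
\<close>

definition folds_to :: "nat \<Rightarrow> nat \<Rightarrow> (nat list \<rightharpoonup> nat) \<Rightarrow> (nat list \<rightharpoonup> nat) \<times> (nat list \<Rightarrow> nat) \<Rightarrow> bool" where
  "folds_to d k P = (\<lambda>(Q, w). dom P \<subseteq> cells d \<and> proper_partial (folded_cube d) k Q \<and>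
     (\<forall>c s. P c = Some s \<longrightarrow> Q (representative c) = Some s) \<and>
     (\<forall>v \<in> dom Q. v \<in> dom P \<or> antipode v \<in> dom P) \<and>
     (\<forall>v \<in> pverts (folded_cube d). w v = of_bool (P v = None) + of_bool (P (antipode v) = None)))"

text \<open>
  Lowering the weight of a coloured vertex amounts to assigning its own colour once more.  In this
  form both kinds of turns look like a turn of the stabilized game.
\<close>

lemma modified_turn_iff_assign_colour:
  assumes "graph G" "proper_partial G k Q" and "\<And>v. v \<in> verts G \<Longrightarrow> Q v = None \<Longrightarrow> 0 < w v"
  shows "modified_turn G k (Q, w) q \<longleftrightarrow>
    (\<exists>v s. v \<in> verts G \<and> s \<in> {1..k} \<and> Q v \<in> {None, Some s} \<and> (\<forall>u. u \<rightarrow>\<^bsub>G\<^esub> v \<longrightarrow> Q u \<noteq> Some s) \<and>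
       0 < w v \<and> q = (Q(v \<mapsto> s), w(v := w v - 1)))" (is "?L \<longleftrightarrow> ?R")
proof
  assume ?L
  then show ?R
  proof (cases rule: modified_turn_cases)
    case (colour v s)
    then show ?thesis using assms(3) by blast
  next
    case (discard v)
    obtain s where s: "Q v = Some s" using discard by blast
    have "Q u \<noteq> Some s" if "u \<rightarrow>\<^bsub>G\<^esub> v" for u
    proof
      assume "Q u = Some s"
      then have "u \<in> dom Q" "Q u = Q v" using s by auto
      then show False using assms(2) that unfolding proper_partial_def by blast
    qed
    moreover have "s \<in> {1..k}"
      using assms(2) s unfolding proper_partial_def by (auto intro: ranI)
    moreover have "Q(v \<mapsto> s) = Q" using s by auto
    ultimately show ?thesis using discard s by (intro exI[of _ v] exI[of _ s]) auto
  qed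
next
  assume ?R
  then obtain v s where v: "v \<in> verts G" "s \<in> {1..k}" "Q v \<in> {None, Some s}"
    "\<forall>u. u \<rightarrow>\<^bsub>G\<^esub> v \<longrightarrow> Q u \<noteq> Some s" "0 < w v" "q = (Q(v \<mapsto> s), w(v := w v - 1))" by blast
  show ?L
  proof (cases "Q v = None")
    case True
    then show ?thesis using v modified_turn_colour[of v G Q s k w] by blast
  next
    case False
    then have "Q(v \<mapsto> s) = Q" using v(3) by auto
    then show ?thesis using v False unfolding modified_turn_iff by auto
  qed
qed

lemma graph_folded_cube:
  assumes "2 \<le> d"
  shows "graph (folded_cube d)"
proof -
  have "finite (pverts (folded_cube d))" "finite (pverts (folded_cube d) \<times> pverts (folded_cube d))"
    using finite_cells[of d] by (auto simp: folded_cube_def)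
  moreover have "u \<noteq> v" if "(u, v) \<in> parcs (folded_cube d)" for u v
  proof
    assume "u = v"
    moreover have "hamming_distance u u = 0" "hamming_distance u (antipode u) = d"
      using that hamming_distance_antipode[of u u] hamming_distance_eq_0_iff[of u u]
      by (auto simp: folded_cube_def cells_def)
    ultimately show False
      using that assms by (auto simp: parcs_folded_cube collinear_up_to_antipode_def)
  qed
  moreover have "parcs (folded_cube d) \<subseteq> pverts (folded_cube d) \<times> pverts (folded_cube d)"
    by (auto simp: folded_cube_def)
  moreover have "sym (parcs (folded_cube d))"
    using collinear_up_to_antipode_sym by (auto simp: folded_cube_def sym_def)
  ultimately have "pair_graph (folded_cube d)"
    by unfold_locales (auto simp: symmetric_def intro: finite_subset)
  then show ?thesis by (rule pair_graph.pair_graphD_graph)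
qed

lemma folds_to_colour:
  "folds_to d k P (Q, w) \<Longrightarrow> P c = Some s \<Longrightarrow> c \<in> cells d \<and> Q (representative c) = Some s"
  by (auto simp: folds_to_def)

lemma folds_to_colour_origin:
  assumes R: "folds_to d k P (Q, w)" and "0 < d" and v: "Q v = Some s"
  shows "P v = Some s \<or> P (antipode v) = Some s"
proof -
  have v': "v \<in> dom P \<or> antipode v \<in> dom P" "v \<in> pverts (folded_cube d)"
    using R v by (auto simp: folds_to_def proper_partial_def)
  then have "representative v = v" "representative (antipode v) = v"
    using representative_eq_iff[of v d v] representative_antipode[of v d] \<open>0 < d\<close>
    by (simp_all add: pverts_folded_cube)
  then have "P x = Some s" if "x \<in> dom P" "x = v \<or> x = antipode v" for x
    using that v folds_to_colour[OF R] by fastforce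
  then show ?thesis using v'(1) by blast
qed

text \<open>
  The neighbours of a folded vertex come from the cells collinear with either cell of its pair, which
  is why the conditions on both cells merge into properness at one vertex.
\<close>

lemma folds_to_legal_iff:
  assumes R: "folds_to d k P (Q, w)" and "0 < d" and c: "c \<in> cells d" "P c = None"
  shows "P (antipode c) \<in> {None, Some s} \<and> (\<forall>u. collinear_up_to_antipode d u c \<longrightarrow> P u \<noteq> Some s) \<longleftrightarrow>
    Q (representative c) \<in> {None, Some s} \<and>
    (\<forall>u. u \<rightarrow>\<^bsub>with_proj (folded_cube d)\<^esub> representative c \<longrightarrow> Q u \<noteq> Some s)"
    (is "?L \<longleftrightarrow> ?R")
proof
  assume L: ?L
  have "Q (representative c) = Some s" if coloured: "Q (representative c) \<noteq> None"
  proof -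
    obtain t where t: "Q (representative c) = Some t" using coloured by blast
    then have "P (antipode c) = Some t"
      using folds_to_colour_origin[OF R \<open>0 < d\<close> t] c(2)
      by (auto simp: representative_def split: if_splits)
    then show ?thesis using L t by simp
  qed
  moreover have "Q u \<noteq> Some s" if "u \<rightarrow>\<^bsub>with_proj (folded_cube d)\<^esub> representative c" for u
  proof
    assume "Q u = Some s"
    then have "P u = Some s \<or> P (antipode u) = Some s"
      by (rule folds_to_colour_origin[OF R \<open>0 < d\<close>])
    moreover have "collinear_up_to_antipode d u c" "collinear_up_to_antipode d (antipode u) c"
      using that by (simp_all add: parcs_folded_cube)
    ultimately show False using L by blast
  qed
  ultimately show ?R by blast
next
  assume L: ?R
  have "t = s" if "P (antipode c) = Some t" for t
    using L folds_to_colour[OF R that] representative_antipode[OF c(1) \<open>0 < d\<close>] by simp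
  moreover have "P u \<noteq> Some s" if u: "collinear_up_to_antipode d u c" for u
  proof
    assume "P u = Some s"
    then have "Q (representative u) = Some s" "u \<in> cells d" using folds_to_colour[OF R] by auto
    moreover have "representative u \<rightarrow>\<^bsub>with_proj (folded_cube d)\<^esub> representative c"
      using u c(1) \<open>u \<in> cells d\<close> \<open>0 < d\<close> representative_in_folded_cube by (simp add: parcs_folded_cube)
    ultimately show False using L by blast
  qed
  ultimately show ?L by (cases "P (antipode c)") auto
qed

lemma folds_to_turn:
  assumes R: "folds_to d k P (Q, w)" and "2 \<le> d" and c: "c \<in> cells d" "P c = None" "s \<in> {1..k}"
    and Q: "Q (representative c) \<in> {None, Some s}"
      "\<And>u. u \<rightarrow>\<^bsub>with_proj (folded_cube d)\<^esub> representative c \<Longrightarrow> Q u \<noteq> Some s"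
  shows "folds_to d k (P(c \<mapsto> s))
    (Q(representative c \<mapsto> s), w(representative c := w (representative c) - 1))"
proof -
  let ?F = "with_proj (folded_cube d)" and ?r = "representative c"
  have d: "0 < d" using assms by simp
  interpret graph ?F using \<open>2 \<le> d\<close> by (rule graph_folded_cube)
  have ac: "antipode c \<noteq> c" using antipode_neq[OF c(1) d] .
  have r: "?r \<in> pverts (folded_cube d)" using representative_in_folded_cube c d by simp
  have "proper_partial ?F k (Q(?r \<mapsto> s))"
  proof (cases "Q ?r = None")
    case True
    then show ?thesis
      using R r c Q proper_partial_colour[of k Q ?r s] by (simp add: folds_to_def)
  next
    case False
    then have "Q(?r \<mapsto> s) = Q" using Q(1) by auto
    then show ?thesis using R by (simp add: folds_to_def)
  qed
  moreover have "(Q(?r \<mapsto> s)) (representative x) = Some t" if "(P(c \<mapsto> s)) x = Some t" for x t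
  proof (cases "x = c")
    case True
    then show ?thesis using that by simp
  next
    case False
    then have "Q (representative x) = Some t" using that folds_to_colour[OF R] by simp
    then show ?thesis using Q(1) by auto
  qed
  moreover have "v \<in> dom (P(c \<mapsto> s)) \<or> antipode v \<in> dom (P(c \<mapsto> s))"
    if "v \<in> dom (Q(?r \<mapsto> s))" for v
  proof (cases "v = ?r")
    case True
    then show ?thesis by (auto simp: representative_def)
  next
    case False
    then show ?thesis using that R by (auto simp: folds_to_def)
  qed
  moreover have "(w(?r := w ?r - 1)) v =
      of_bool ((P(c \<mapsto> s)) v = None) + of_bool ((P(c \<mapsto> s)) (antipode v) = None)"
    if v: "v \<in> pverts (folded_cube d)" for v
  proof -
    have w: "w v = of_bool (P v = None) + of_bool (P (antipode v) = None)"
      using R v by (simp add: folds_to_def)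
    have iff: "?r = v \<longleftrightarrow> c = v \<or> c = antipode v"
      using representative_eq_iff[OF c(1) d v] .
    show ?thesis
    proof (cases "?r = v")
      case True
      then consider "v = c" | "antipode v = c" "v \<noteq> c" using iff ac by fastforce
      then show ?thesis
      proof cases
        case 1
        then show ?thesis using True w c(2) ac by simp
      next
        case 2
        then show ?thesis using True w c(2) by simp
      qed
    next
      case False
      then show ?thesis using iff w by auto
    qed
  qed
  moreover have "dom (P(c \<mapsto> s)) \<subseteq> cells d" using R c by (auto simp: folds_to_def)
  ultimately show ?thesis unfolding folds_to_def by simp
qed

lemma folds_to_modified_turn_iff:
  assumes R: "folds_to d k P (Q, w)" and "2 \<le> d"
  shows "modified_turn (folded_cube d) k (Q, w) q \<longleftrightarrow>
    (\<exists>v s. v \<in> pverts (folded_cube d) \<and> s \<in> {1..k} \<and> Q v \<in> {None, Some s} \<and>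
       (\<forall>u. u \<rightarrow>\<^bsub>with_proj (folded_cube d)\<^esub> v \<longrightarrow> Q u \<noteq> Some s) \<and>
       0 < w v \<and> q = (Q(v \<mapsto> s), w(v := w v - 1)))"
proof -
  have "proper_partial (folded_cube d) k Q" using R by (simp add: folds_to_def)
  moreover have "0 < w v" if v: "v \<in> pverts (folded_cube d)" "Q v = None" for v
  proof -
    have "representative v = v" using v(1) by (simp add: representative_def pverts_folded_cube)
    then have "P v = None" using folds_to_colour[OF R, of v] v(2) by (cases "P v") auto
    then show ?thesis using R v(1) by (simp add: folds_to_def)
  qed
  ultimately show ?thesis
    using modified_turn_iff_assign_colour[OF graph_folded_cube[OF \<open>2 \<le> d\<close>], of k Q w q] by simp
qed

lemma folds_to_stabilized_turn_iff:
  assumes R: "folds_to d k P (Q, w)" and "2 \<le> d"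
  shows "stabilized_turn (swap_isotopism d) (hypercube d) k P P' \<longleftrightarrow>
    (\<exists>c s. c \<in> cells d \<and> P c = None \<and> s \<in> {1..k} \<and> P' = P(c \<mapsto> s) \<and>
       Q (representative c) \<in> {None, Some s} \<and>
       (\<forall>u. u \<rightarrow>\<^bsub>with_proj (folded_cube d)\<^esub> representative c \<longrightarrow> Q u \<noteq> Some s))"
proof -
  have d: "0 < d" using \<open>2 \<le> d\<close> by simp
  have "dom P \<subseteq> cells d" using R by (simp add: folds_to_def)
  moreover have "P (antipode c) \<in> {None, Some s}" if "P c = Some s" for c s
  proof (cases "P (antipode c)")
    case (Some t)
    then show ?thesis
      using folds_to_colour[OF R that] folds_to_colour[OF R Some] representative_antipode[of c d] d by simp
  qed simp
  moreover have "P u \<noteq> P v" if uv: "u \<in> dom P" "collinear_up_to_antipode d u v" for u v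
  proof
    assume "P u = P v"
    obtain s where s: "P u = Some s" using uv(1) by blast
    have cells: "u \<in> cells d" "v \<in> cells d" using uv(2) by (auto simp: collinear_up_to_antipode_def)
    then have arc: "representative u \<rightarrow>\<^bsub>with_proj (folded_cube d)\<^esub> representative v"
      using uv representative_in_folded_cube d by (simp add: parcs_folded_cube)
    moreover have "Q (representative u) = Some s" "Q (representative v) = Some s"
      using folds_to_colour[OF R] s \<open>P u = P v\<close> by auto
    moreover have "proper_partial (folded_cube d) k Q" using R by (simp add: folds_to_def)
    ultimately show False unfolding proper_partial_def by (metis domI)
  qed
  ultimately have "stabilized_turn (swap_isotopism d) (hypercube d) k P P' \<longleftrightarrow>
    (\<exists>c s. c \<in> cells d \<and> P c = None \<and> s \<in> {1..k} \<and> P' = P(c \<mapsto> s) \<and>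
       P (antipode c) \<in> {None, Some s} \<and> (\<forall>u. collinear_up_to_antipode d u c \<longrightarrow> P u \<noteq> Some s))"
    by (rule stabilized_turn_swap_isotopism_iff[OF \<open>2 \<le> d\<close>])
  then show ?thesis by (simp only: folds_to_legal_iff[OF R d] cong: conj_cong)
qed

text \<open>
  Folding is a bisimulation.  A turn of the modified game at a vertex of positive weight is realised
  in any empty cell of the pair.
\<close>

lemma stabilized_win_iff_modified_win:
  assumes "2 \<le> d"
  shows "alice_wins X a b (stabilized_turn (swap_isotopism d) (hypercube d) k) Map.empty
      (\<lambda>P. pverts (hypercube d) \<subseteq> dom P)
    \<longleftrightarrow> modified_win X a b (folded_cube d) k (\<lambda>_. 2)"
proof -
  let ?F = "with_proj (folded_cube d)" and ?turn = "stabilized_turn (swap_isotopism d) (hypercube d) k"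
  have d: "0 < d" using assms by simp
  interpret graph ?F using assms by (rule graph_folded_cube)
  have new_cell: "\<exists>c \<in> pverts (hypercube d). P c = None \<and> P' c \<noteq> None" if turn: "?turn P P'" for P P'
  proof -
    obtain c where "c \<in> pverts (hypercube d) - dom P"
      and "\<exists>s \<in> {1..k}. P' = P(c \<mapsto> s)" using turn unfolding stabilized_turn_def by fast
    then show ?thesis by auto
  qed
  have simulates: "\<exists>q'. modified_turn ?F k q q' \<and> folds_to d k P' q'"
    if R: "folds_to d k P q" and turn: "?turn P P'" for P q P'
  proof -
    obtain Q w where q: "q = (Q, w)" by (cases q)
    note R = R[unfolded q]
    obtain c s where c: "c \<in> cells d" "P c = None" "s \<in> {1..k}" "P' = P(c \<mapsto> s)"
      and Q: "Q (representative c) \<in> {None, Some s}"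
        "\<forall>u. u \<rightarrow>\<^bsub>?F\<^esub> representative c \<longrightarrow> Q u \<noteq> Some s"
      using turn unfolding folds_to_stabilized_turn_iff[OF R assms] by blast
    have r: "representative c \<in> pverts (folded_cube d)"
      using representative_in_folded_cube c(1) d by simp
    then have "w (representative c) =
        of_bool (P (representative c) = None) + of_bool (P (antipode (representative c)) = None)"
      using R by (simp add: folds_to_def)
    then have "0 < w (representative c)" using c(2) by (auto simp: representative_def)
    then have "modified_turn ?F k (Q, w)
        (Q(representative c \<mapsto> s), w(representative c := w (representative c) - 1))"
      using r c(3) Q unfolding folds_to_modified_turn_iff[OF R assms] by blast
    moreover have "folds_to d k P'
        (Q(representative c \<mapsto> s), w(representative c := w (representative c) - 1))"
      using folds_to_turn[OF R assms c(1-3)] Q c(4) by blast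
    ultimately show ?thesis unfolding q by blast
  qed
  have simulated: "\<exists>P'. ?turn P P' \<and> folds_to d k P' q'"
    if R: "folds_to d k P q" and turn: "modified_turn ?F k q q'" for P q q'
  proof -
    obtain Q w where q: "q = (Q, w)" by (cases q)
    note R = R[unfolded q]
    obtain v s where v: "v \<in> pverts (folded_cube d)" "s \<in> {1..k}" "0 < w v"
        "q' = (Q(v \<mapsto> s), w(v := w v - 1))"
      and Q: "Q v \<in> {None, Some s}" "\<forall>u. u \<rightarrow>\<^bsub>?F\<^esub> v \<longrightarrow> Q u \<noteq> Some s"
      using turn unfolding q folds_to_modified_turn_iff[OF R assms] by blast
    have "w v = of_bool (P v = None) + of_bool (P (antipode v) = None)"
      using R v(1) by (simp add: folds_to_def)
    then obtain c where c: "c = v \<or> c = antipode v" "P c = None"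
      using v(3) by (cases "P v = None") auto
    then have c': "c \<in> cells d" using v(1) by (auto simp: pverts_folded_cube)
    have rc: "representative c = v"
      using c(1) representative_eq_iff[OF c' d v(1)] by blast
    have "?turn P (P(c \<mapsto> s))"
      unfolding folds_to_stabilized_turn_iff[OF R assms] using c(2) c' v(2) Q rc by blast
    moreover have "folds_to d k (P(c \<mapsto> s)) q'"
      using folds_to_turn[OF R assms c' c(2) v(2)] Q unfolding rc v(4) by blast
    ultimately show ?thesis by blast
  qed
  show ?thesis
  proof (rule alice_wins_iff_bisimulation[where R = "folds_to d k"])
    show "\<not> ?turn P P" for P using new_cell by blast
    show "\<not> modified_turn ?F k q q" for q by (rule modified_turn_irrefl)
    show "folds_to d k Map.empty (Map.empty, \<lambda>_. 2)" by (simp add: folds_to_def)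
    show "pverts (hypercube d) \<subseteq> dom P'" if "pverts (hypercube d) \<subseteq> dom P" "?turn P P'" for P P'
      using new_cell that by blast
    show "(\<lambda>(Q, w). verts ?F \<subseteq> dom Q) q'"
      if "(\<lambda>(Q, w). verts ?F \<subseteq> dom Q) q" "modified_turn ?F k q q'" for q q'
      using that dom_turn_mono[of k "fst q" "snd q" "fst q'" "snd q'"] by (auto simp: case_prod_beta)
    show "\<exists>q'. modified_turn ?F k q q' \<and> folds_to d k P' q'"
      if "folds_to d k P q" "?turn P P'" for P q P' using simulates that .
    show "\<exists>P'. ?turn P P' \<and> folds_to d k P' q'"
      if "folds_to d k P q" "modified_turn ?F k q q'" for P q q' using simulated that .
    fix P q
    assume R: "folds_to d k P q" and stuck: "\<nexists>q'. modified_turn ?F k q q'"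
    obtain Q w where q: "q = (Q, w)" by (cases q)
    note R = R[unfolded q]
    have vw: "w v = of_bool (P v = None) + of_bool (P (antipode v) = None)" "representative v = v" "v \<in> cells d"
      if "v \<in> pverts (folded_cube d)" for v
      using R that by (auto simp: folds_to_def representative_def pverts_folded_cube)
    have "pverts (hypercube d) \<subseteq> dom P \<longleftrightarrow> verts ?F \<subseteq> dom Q"
    proof
      assume full: "pverts (hypercube d) \<subseteq> dom P"
      show "verts ?F \<subseteq> dom Q"
      proof
        fix v assume "v \<in> verts ?F"
        then have v: "v \<in> pverts (folded_cube d)" by simp
        then obtain s where "P v = Some s" using full vw(3)[OF v] unfolding pverts_hypercube by blast
        then show "v \<in> dom Q" using folds_to_colour[OF R, of v s] vw(2)[OF v] by auto
      qed
    next
      assume full: "verts ?F \<subseteq> dom Q"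
      show "pverts (hypercube d) \<subseteq> dom P"
      proof
        fix c assume "c \<in> pverts (hypercube d)"
        then have c: "c \<in> cells d" by (simp add: pverts_hypercube)
        have r: "representative c \<in> pverts (folded_cube d)"
          using representative_in_folded_cube c d by simp
        have "w (representative c) = 0"
          using stuck full r unfolding q modified_turn_iff by (metis IntI gr0I subsetD with_proj_simps(1))
        then have "P (representative c) \<noteq> None" "P (antipode (representative c)) \<noteq> None"
          using vw(1)[OF r] by auto
        then show "c \<in> dom P" by (auto simp: representative_def split: if_splits)
      qed
    qed
    then show "pverts (hypercube d) \<subseteq> dom P \<longleftrightarrow> (\<lambda>(Q, w). verts ?F \<subseteq> dom Q) q" by (simp add: q)
  qed
qed

section \<open>Small folded cubes\<close>

text \<open>
  Representatives share their first coordinate, so they are never antipodal and have distance less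
  than \<open>d\<close>.
\<close>

lemma folded_cube_adjacency:
  assumes "u \<in> pverts (folded_cube d)" "v \<in> pverts (folded_cube d)" "0 < d"
  shows "(u, v) \<in> parcs (folded_cube d) \<longleftrightarrow> hamming_distance u v = 1 \<or> hamming_distance u v = d - 1"
    and "hamming_distance u v < d" and "hamming_distance u v = 0 \<longleftrightarrow> u = v"
proof -
  have cells: "u \<in> cells d" "v \<in> cells d" "hd u = 1" "hd v = 1"
    using assms by (auto simp: pverts_folded_cube)
  then have sum: "hamming_distance u (antipode v) + hamming_distance u v = d"
    using hamming_distance_antipode[of u v] by (simp add: cells_def)
  have "u \<noteq> antipode v" using hd_antipode[of v d] cells assms(3) by auto
  then have "hamming_distance u (antipode v) \<noteq> 0"
    using hamming_distance_eq_0_iff[of u "antipode v"] cells by (simp add: cells_def antipode_def)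
  then show "hamming_distance u v < d" using sum by simp
  show "hamming_distance u v = 0 \<longleftrightarrow> u = v"
    using cells by (simp add: hamming_distance_eq_0_iff cells_def)
  show "(u, v) \<in> parcs (folded_cube d) \<longleftrightarrow> hamming_distance u v = 1 \<or> hamming_distance u v = d - 1"
    using assms sum cells by (auto simp: parcs_folded_cube collinear_up_to_antipode_def)
qed

lemma card_folded_cube:
  assumes "0 < d"
  shows "finite (pverts (folded_cube d))" "card (pverts (folded_cube d)) = 2 ^ (d - 1)"
proof -
  have "pverts (folded_cube d) = (#) 1 ` cells (d - 1)"
  proof (intro set_eqI iffI)
    fix c assume "c \<in> pverts (folded_cube d)"
    then show "c \<in> (#) 1 ` cells (d - 1)"
      using assms by (cases c) (auto simp: pverts_folded_cube cells_def)
  qed (use assms in \<open>auto simp: pverts_folded_cube cells_def\<close>)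
  moreover have "card (cells (d - 1)) = 2 ^ (d - 1)"
    using card_lists_length_eq[of "{1, 2 :: nat}" "d - 1"] by (simp add: cells_def conj_commute numeral_2_eq_2)
  ultimately show "finite (pverts (folded_cube d))" "card (pverts (folded_cube d)) = 2 ^ (d - 1)"
    by (simp_all add: card_image finite_cells)
qed

lemma complete_folded_square: "K\<^bsub>2\<^esub> (folded_cube 2)"
proof -
  have "(u, v) \<in> parcs (folded_cube 2) \<longleftrightarrow> u \<noteq> v"
    if "u \<in> pverts (folded_cube 2)" "v \<in> pverts (folded_cube 2)" for u v
    using folded_cube_adjacency[OF that] by auto
  then show ?thesis
    using card_folded_cube[of 2] by (auto simp: complete_digraph_pair_def parcs_folded_cube)
qed

lemma complete_folded_three_cube: "K\<^bsub>4\<^esub> (folded_cube 3)"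
proof -
  have "(u, v) \<in> parcs (folded_cube 3) \<longleftrightarrow> u \<noteq> v"
    if "u \<in> pverts (folded_cube 3)" "v \<in> pverts (folded_cube 3)" for u v
    using folded_cube_adjacency[OF that] by auto
  then show ?thesis
    using card_folded_cube[of 3] by (auto simp: complete_digraph_pair_def parcs_folded_cube)
qed

lemma even_hamming_distance:
  assumes "length u = length v" "set u \<subseteq> {1, 2}" "set v \<subseteq> {1, 2}"
  shows "even (hamming_distance u v) \<longleftrightarrow> (even (sum_list u) \<longleftrightarrow> even (sum_list v))"
  using assms by (induction u v rule: list_induct2) (auto simp: hamming_distance_def)

text \<open>
  Distances between representatives lie in \<open>{0, 1, 2, 3}\<close>, and adjacency holds exactly for the odd
  ones; these occur between cells of different parity.
\<close>

lemma complete_bipartite_folded_four_cube: "K\<^bsub>4,4\<^esub> (folded_cube 4)"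
proof -
  let ?F = "folded_cube 4"
  define U where "U = {c \<in> pverts ?F. even (sum_list c)}"
  define V where "V = {c \<in> pverts ?F. odd (sum_list c)}"
  have vertex: "c \<in> pverts ?F \<longleftrightarrow> (\<exists>x \<in> {1, 2}. \<exists>y \<in> {1, 2}. \<exists>z \<in> {1, 2}. c = [1, x, y, z])" for c
  proof
    assume "c \<in> pverts ?F"
    then have c: "length c = Suc (Suc (Suc (Suc 0)))" "set c \<subseteq> {1, 2}" "hd c = 1"
      by (simp_all add: pverts_folded_cube cells_def)
    from c(1) obtain t x y z where "c = [t, x, y, z]" by (auto simp only: length_Suc_conv length_0_conv)
    with c(2,3) show "\<exists>x \<in> {1, 2}. \<exists>y \<in> {1, 2}. \<exists>z \<in> {1, 2}. c = [1, x, y, z]" by auto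
  next
    assume "\<exists>x \<in> {1, 2}. \<exists>y \<in> {1, 2}. \<exists>z \<in> {1, 2}. c = [1, x, y, z]"
    then show "c \<in> pverts ?F" by (elim bexE) (simp add: pverts_folded_cube cells_def)
  qed
  have "U = {[1, 1, 1, 1], [1, 1, 2, 2], [1, 2, 1, 2], [1, 2, 2, 1]}"
    unfolding U_def vertex by auto
  then have "card U = 4" by simp
  have "V = {[1, 1, 1, 2], [1, 1, 2, 1], [1, 2, 1, 1], [1, 2, 2, 2]}"
    unfolding V_def vertex by auto
  then have "card V = 4" by simp
  have "(u, v) \<in> parcs ?F \<longleftrightarrow> (even (sum_list u) \<longleftrightarrow> odd (sum_list v))"
    if uv: "u \<in> pverts ?F" "v \<in> pverts ?F" for u v
  proof -
    have "(u, v) \<in> parcs ?F \<longleftrightarrow> hamming_distance u v \<in> {1, 3}" "hamming_distance u v < 4"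
      using folded_cube_adjacency[OF uv] by auto
    moreover have "n \<in> {1, 3} \<longleftrightarrow> odd n" if "n < 4" for n :: nat
    proof -
      have "n = 0 \<or> n = 1 \<or> n = 2 \<or> n = 3" using that by linarith
      then show ?thesis by (elim disjE) simp_all
    qed
    ultimately show ?thesis
      using even_hamming_distance[of u v] uv by (auto simp: pverts_folded_cube cells_def)
  qed
  then have "parcs ?F = U \<times> V \<union> V \<times> U"
    unfolding U_def V_def using parcs_folded_cube by fastforce
  moreover have "pverts ?F = U \<union> V" "U \<inter> V = {}" unfolding U_def V_def by auto
  ultimately show ?thesis
    unfolding complete_bipartite_digraph_pair_def
    using card_folded_cube(1)[of 4] \<open>card U = 4\<close> \<open>card V = 4\<close> by auto
qed

section \<open>Game chromatic numbers\<close>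

lemma modified_game_chi_eqI:
  assumes "\<And>k. modified_win X a b G k (\<lambda>_. l) \<longleftrightarrow> m \<le> k"
  shows "modified_game_chi X a b (uniform_weight G l) = m"
  unfolding modified_game_chi_def uniform_weight_def fst_conv snd_conv assms
  by (rule Least_equality) simp_all

text \<open>
  The stabilized number only ranges over at least two symbols, hence the assumption \<open>2 \<le> m\<close>.
\<close>

lemma stabilized_game_chi_eqI:
  assumes "2 \<le> d" "2 \<le> m" "\<And>k. modified_win X a b (folded_cube d) k (\<lambda>_. 2) \<longleftrightarrow> m \<le> k"
  shows "stabilized_game_chi X a b 2 (swap_isotopism d) (hypercube d) = m"
  unfolding stabilized_game_chi_def natural_extension_swap_isotopism
    stabilized_win_iff_modified_win[OF assms(1)] assms(3)
  using assms(2) by (intro Least_equality) simp_all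

theorem theorem26:
  fixes a b d :: nat and \<Theta> :: isotopism
  assumes "a > 0" and "b > 0" and "d > 0"
    and "\<Theta> = (replicate d (Transposition.transpose 1 2), id)"
  shows
    "(d = 2 \<longrightarrow>
       (\<forall>X. stabilized_game_chi X a b 2 \<Theta> (hypercube 2) = 2 \<and>
          (\<forall>G :: ('v, 'e) pre_digraph. K\<^bsub>2\<^esub> G \<longrightarrow>
             stabilized_game_chi X a b 2 \<Theta> (hypercube 2) = modified_game_chi X a b (uniform_weight G 2)))) \<and>
     (d = 3 \<longrightarrow>
       (\<forall>X. stabilized_game_chi X a b 2 \<Theta> (hypercube 3) = 4 \<and>
          (\<forall>G :: ('v, 'e) pre_digraph. K\<^bsub>4\<^esub> G \<longrightarrow>
             stabilized_game_chi X a b 2 \<Theta> (hypercube 3) = modified_game_chi X a b (uniform_weight G 2)))) \<and>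
     (d = 4 \<longrightarrow>
       (\<forall>X. (\<forall>G :: ('v, 'e) pre_digraph. K\<^bsub>4,4\<^esub> G \<longrightarrow>
               stabilized_game_chi X a b 2 \<Theta> (hypercube 4) = modified_game_chi X a b (uniform_weight G 2)) \<and>
            (X = Alice \<and> a \<ge> 2 \<longrightarrow> stabilized_game_chi X a b 2 \<Theta> (hypercube 4) = 2) \<and>
            (X = Alice \<and> a = 1 \<longrightarrow>
               stabilized_game_chi X a b 2 \<Theta> (hypercube 4) = min (b + 2) 5) \<and>
            (X = Bob \<and> a = 1 \<longrightarrow>
               stabilized_game_chi X a b 2 \<Theta> (hypercube 4) = min (b + 1) 5)))"
proof -
  have \<Theta>: "\<Theta> = swap_isotopism d" using assms(4) by (simp add: swap_isotopism_def)
  have square: "stabilized_game_chi X a b 2 (swap_isotopism 2) (hypercube 2) = 2" for X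
    by (rule stabilized_game_chi_eqI[OF _ _ modified_win_complete_iff[OF complete_folded_square]]) simp_all
  have cube: "stabilized_game_chi X a b 2 (swap_isotopism 3) (hypercube 3) = 4" for X
    by (rule stabilized_game_chi_eqI[OF _ _ modified_win_complete_iff[OF complete_folded_three_cube]]) simp_all
  have complete: "modified_game_chi X a b (uniform_weight G 2) = n"
    if "K\<^bsub>n\<^esub> G" for X n and G :: "('v, 'e) pre_digraph"
    by (rule modified_game_chi_eqI) (rule modified_win_complete_iff[OF that])
  have tesseract: "stabilized_game_chi X a b 2 (swap_isotopism 4) (hypercube 4) = bipartite_bound X a b 4"
    if "0 < a" "0 < b" for X a b
    using that
    by (intro stabilized_game_chi_eqI modified_win_bipartite_iff[OF complete_bipartite_folded_four_cube])
      (simp_all add: bipartite_bound_def)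
  have bipartite: "modified_game_chi X a b (uniform_weight G 2) = bipartite_bound X a b 4"
    if "K\<^bsub>4,4\<^esub> G" for X and G :: "('v, 'e) pre_digraph"
    using assms(1,2) by (intro modified_game_chi_eqI modified_win_bipartite_iff[OF that]) simp_all
  show ?thesis
    unfolding \<Theta> using assms(1,2) by (auto simp: square cube tesseract complete bipartite bipartite_bound_def)
qed

end
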